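(* Let $3\le s\le k\le5$ be integers and let $u$ be a totally real algebraic integer with $2<u<14$ such that the matrix $$A=\begin{pmatrix}-2&u&2\cos\frac{\pi}{s}\\ u&-2&2\cos\frac{\pi}{k}\\ 2\cos\frac{\pi}{s}&2\cos\frac{\pi}{k}&-2\end{pmatrix}$$ is V-arithmetic, with ground field $\mathbb K=\mathbb Q\big(u^2,\cos^2\frac{\pi}{s},\cos^2\frac{\pi}{k},u\cos\frac{\pi}{s}\cos\frac{\pi}{k}\big)$. Then: $[\mathbb K:\mathbb Q]\le23$ for $s=k=3$; $[\mathbb K:\mathbb Q]\le12$ for $s=3,k=4$; $[\mathbb K:\mathbb Q]\le8$ for $s=k=4$; $\mathbb Q(\sqrt5)\subset\mathbb K$ and $[\mathbb K:\mathbb Q(\sqrt5)]\le7$ for $s=3,k=5$; for $s=4,k=5$: if $\sqrt2\in\mathbb K$ then $\mathbb Q(\sqrt2,\sqrt5)\subset\mathbb K$ and $[\mathbb K:\mathbb Q(\sqrt2,\sqrt5)]\le5$, and if $\sqrt2\notin\mathbb K$ then $\mathbb Q(\sqrt5)\subset\mathbb K$ and $[\mathbb K:\mathbb Q(\sqrt5)]\le11$; $\mathbb Q(\sqrt5)\subset\mathbb K$ and $[\mathbb K:\mathbb Q(\sqrt5)]\le6$ for $s=k=5$. In particular $[\mathbb K:\mathbb Q]\le23$ in all these cases.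
   Context: A fundamental matrix is a real symmetric matrix $A=(a_{ij})$ with $a_{ii}=-2$, $a_{ij}\ge0$ for $i\ne j$, and $a_{ij}=2\cos(\pi/m_{ij})$ for an integer $m_{ij}\ge2$ whenever $a_{ij}<2$. It is hyperbolic if it has exactly one positive eigenvalue. Its cyclic products are $a_{i_1i_2}a_{i_2i_3}\cdots a_{i_ki_1}$; its ground field $\mathbb K$ is the field generated over $\mathbb Q$ by all cyclic products. A hyperbolic fundamental matrix is V-arithmetic if all cyclic products are algebraic integers, the field $\mathbb Q(\{a_{ij}\})$ is totally real, and for every embedding $\varphi:\mathbb Q(\{a_{ij}\})\to\mathbb R$ whose restriction to $\mathbb K$ is not the identity inclusion, the matrix $(\varphi(a_{ij}))$ is negative definite. All fields are regarded as subfields of $\mathbb R$. *)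

theory Defs
  imports "Jordan_Normal_Form.Char_Poly" "HOL-Library.Extended_Nat"
begin

definition is_subfield :: "real set \<Rightarrow> bool" where
  "is_subfield F \<longleftrightarrow> 0 \<in> F \<and> 1 \<in> F \<and>
     (\<forall>x\<in>F. \<forall>y\<in>F. x + y \<in> F \<and> - x \<in> F \<and> x * y \<in> F \<and> inverse x \<in> F)"

text \<open>The subfield of the reals generated over the rationals by a set X (the rationals for X empty).\<close>
definition gen_field :: "real set \<Rightarrow> real set" where
  "gen_field X = \<Inter> {F. is_subfield F \<and> X \<subseteq> F}"

text \<open>Ring homomorphism defined on the field F (automatically an embedding).\<close>
definition hom_on :: "real set \<Rightarrow> (real \<Rightarrow> 'a::field) \<Rightarrow> bool" where
  "hom_on F \<phi> \<longleftrightarrow> \<phi> 1 = 1 \<and>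
     (\<forall>x\<in>F. \<forall>y\<in>F. \<phi> (x + y) = \<phi> x + \<phi> y \<and> \<phi> (x * y) = \<phi> x * \<phi> y)"

definition totally_real :: "real set \<Rightarrow> bool" where
  "totally_real F \<longleftrightarrow> (\<forall>\<phi> :: real \<Rightarrow> complex. hom_on F \<phi> \<longrightarrow> (\<forall>x\<in>F. \<phi> x \<in> \<real>))"

definition totally_real_algebraic_integer :: "real \<Rightarrow> bool" where
  "totally_real_algebraic_integer u \<longleftrightarrow> algebraic_int u \<and> totally_real (gen_field {u})"

definition lin_indep_over :: "real set \<Rightarrow> real set \<Rightarrow> bool" where
  "lin_indep_over L B \<longleftrightarrow>
     (\<forall>c. (\<forall>b\<in>B. c b \<in> L) \<and> (\<Sum>b\<in>B. c b * b) = 0 \<longrightarrow> (\<forall>b\<in>B. c b = 0))"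

definition span_over :: "real set \<Rightarrow> real set \<Rightarrow> real set" where
  "span_over L B = {(\<Sum>b\<in>B. c b * b) | c. \<forall>b\<in>B. c b \<in> L}"

definition basis_over :: "real set \<Rightarrow> real set \<Rightarrow> real set \<Rightarrow> bool" where
  "basis_over L K B \<longleftrightarrow> finite B \<and> B \<subseteq> K \<and> lin_indep_over L B \<and> span_over L B = K"

definition ext_degree :: "real set \<Rightarrow> real set \<Rightarrow> enat" where
  "ext_degree L K = (if \<exists>B. basis_over L K B then enat (card (SOME B. basis_over L K B)) else \<infinity>)"

definition fundamental_matrix :: "real mat \<Rightarrow> bool" where
  "fundamental_matrix A \<longleftrightarrow> A \<in> carrier_mat (dim_row A) (dim_row A) \<and>
     (\<forall>i<dim_row A. \<forall>j<dim_row A. A $$ (i,j) = A $$ (j,i)) \<and>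
     (\<forall>i<dim_row A. A $$ (i,i) = -2) \<and>
     (\<forall>i<dim_row A. \<forall>j<dim_row A. i \<noteq> j \<longrightarrow> A $$ (i,j) \<ge> 0 \<and>
        (A $$ (i,j) < 2 \<longrightarrow> (\<exists>m::nat. m \<ge> 2 \<and> A $$ (i,j) = 2 * cos (pi / real m))))"

definition hyperbolic :: "real mat \<Rightarrow> bool" where
  "hyperbolic A \<longleftrightarrow> fundamental_matrix A \<and>
     (\<Sum>r\<in>{r. r > 0 \<and> poly (char_poly A) r = 0}. order r (char_poly A)) = 1"

definition cyclic_products :: "real mat \<Rightarrow> real set" where
  "cyclic_products A = {(\<Prod>j<length is. A $$ (is ! j, is ! ((j + 1) mod length is))) | is.
      is \<noteq> [] \<and> set is \<subseteq> {..<dim_row A}}"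

definition ground_field :: "real mat \<Rightarrow> real set" where
  "ground_field A = gen_field (cyclic_products A)"

definition entry_field :: "real mat \<Rightarrow> real set" where
  "entry_field A = gen_field {A $$ (i,j) | i j. i < dim_row A \<and> j < dim_row A}"

definition neg_definite :: "real mat \<Rightarrow> bool" where
  "neg_definite M \<longleftrightarrow>
     (\<forall>v\<in>carrier_vec (dim_row M). v \<noteq> 0\<^sub>v (dim_row M) \<longrightarrow> v \<bullet> (M *\<^sub>v v) < 0)"

definition v_arithmetic :: "real mat \<Rightarrow> bool" where
  "v_arithmetic A \<longleftrightarrow> hyperbolic A \<and>
     (\<forall>c\<in>cyclic_products A. algebraic_int c) \<and>
     totally_real (entry_field A) \<and>
     (\<forall>\<phi> :: real \<Rightarrow> real. hom_on (entry_field A) \<phi> \<and> (\<exists>x\<in>ground_field A. \<phi> x \<noteq> x)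
        \<longrightarrow> neg_definite (map_mat \<phi> A))"

definition tri_matrix :: "real \<Rightarrow> nat \<Rightarrow> nat \<Rightarrow> real mat" where
  "tri_matrix u s k = mat_of_rows_list 3
     [[-2, u, 2 * cos (pi / real s)],
      [u, -2, 2 * cos (pi / real k)],
      [2 * cos (pi / real s), 2 * cos (pi / real k), -2]]"

end

theory Submission
  imports Defs "HOL-Computational_Algebra.Field_as_Ring"
begin

text \<open>
  Write \<open>a = 2 cos (\<pi>/s)\<close>, \<open>b = 2 cos (\<pi>/k)\<close> and \<open>q = u\<^sup>2 + u a b\<close>. At every embedding that is not the
  identity on \<open>K\<close> the conjugate matrix is negative definite, which confines the conjugate of \<open>q\<close> to
  \<open>- (a b)\<^sup>2 / 4 \<le> q < 4 - a\<^sup>2 - b\<^sup>2\<close> (with \<open>a\<close>, \<open>b\<close> conjugated as well). In each case a small product \<open>h\<close>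
  of algebraic integers \<open>q + c\<close> and of powers of the unit \<open>b\<close> (for \<open>k = 5\<close>) has absolute value at most
  \<open>\<rho> < 1\<close> on this range, while \<open>|h| \<le> R\<close> at the identity because \<open>u < 14\<close>. The norm of \<open>h\<close> is a nonzero
  integer, so \<open>1 \<le> R \<rho>\<^bsup>[K:\<rat>] - 1\<^esup>\<close>, which bounds the degree.
\<close>

section \<open>Algebraic integers and resultants\<close>

text \<open>The inequality \<open>q < 4 - a^2 - b^2\<close> is the negativity of the determinant of
  the conjugate matrix. It involves \<open>u\<close> only through \<open>q\<close>, and
  \<open>q\<close> lies in \<open>K\<close> because \<open>u^2\<close> and \<open>u a b\<close> are
  cyclic products. The obstacle is that negative definiteness is given for embeddings of the entry
  field \<open>L\<close>, which can be larger than \<open>K\<close>, while the norm runs over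
  embeddings of \<open>K\<close>. As \<open>L\<close> lies in \<open>K(sqrt 2)\<close>, an embedding
  of \<open>K\<close> extends to \<open>L\<close> along one square root, and total reality of
  \<open>L\<close> makes the extension real. Norms are taken over an explicit list of embeddings:
  \<open>K\<close> is generated by \<open>u\<close> or \<open>sqrt 2 * u\<close>, together with
  \<open>sqrt 5\<close> when \<open>k = 5\<close>, so the embeddings come from the roots of one
  minimal polynomial and a sign of \<open>sqrt 5\<close>. Every interval for \<open>q\<close> is
  shorter than 4, the range in which integer polynomials of small sup norm exist; the roots of
  \<open>h\<close> lie in or near it. For \<open>k = 5\<close> there is one interval for each
  conjugate of \<open>b\<close>; the exponent of the unit \<open>b\<close> balances the two sup
  norms and changes the norm of \<open>h\<close> at most by a sign.\<close>

definition int_span :: "'a::comm_ring_1 set \<Rightarrow> 'a set" where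
  "int_span S = {\<Sum>s\<in>S. of_int (c s) * s | c. True}"

lemma int_spanI: "x = (\<Sum>s\<in>S. of_int (c s) * s) \<Longrightarrow> x \<in> int_span S"
  by (auto simp: int_span_def)

lemma int_span_add: "x \<in> int_span S \<Longrightarrow> y \<in> int_span S \<Longrightarrow> x + y \<in> int_span S"
proof -
  assume "x \<in> int_span S" "y \<in> int_span S"
  then obtain c d where "x = (\<Sum>s\<in>S. of_int (c s) * s)" "y = (\<Sum>s\<in>S. of_int (d s) * s)"
    by (auto simp: int_span_def)
  then have "x + y = (\<Sum>s\<in>S. of_int (c s + d s) * s)"
    by (simp add: sum.distrib algebra_simps)
  then show ?thesis by (rule int_spanI)
qed

lemma int_span_scale: "x \<in> int_span S \<Longrightarrow> of_int n * x \<in> int_span S"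
proof -
  assume "x \<in> int_span S"
  then obtain c where "x = (\<Sum>s\<in>S. of_int (c s) * s)" by (auto simp: int_span_def)
  then have "of_int n * x = (\<Sum>s\<in>S. of_int (n * c s) * s)"
    by (simp add: sum_distrib_left mult.assoc)
  then show ?thesis by (rule int_spanI)
qed

lemma int_span_zero: "0 \<in> int_span S"
  unfolding int_span_def by (auto intro!: exI[of _ "\<lambda>_. 0"])

lemma int_span_sum: "(\<And>i. i \<in> I \<Longrightarrow> f i \<in> int_span S) \<Longrightarrow> sum f I \<in> int_span S"
  by (induction I rule: infinite_finite_induct) (auto intro: int_span_zero int_span_add)

lemma int_span_base:
  assumes "finite S" "s \<in> S" shows "s \<in> int_span S"
proof -
  have "(\<Sum>t\<in>S. of_int (if t = s then 1 else 0) * t) = (\<Sum>t\<in>S. if t = s then t else 0)"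
    by (intro sum.cong) auto
  also have "\<dots> = s" using assms by simp
  finally show ?thesis by (intro int_spanI) (rule sym)
qed

lemma int_span_mult:
  assumes "\<And>s. s \<in> S \<Longrightarrow> z * s \<in> int_span S" "x \<in> int_span S"
  shows "z * x \<in> int_span S"
proof -
  obtain c where x: "x = (\<Sum>s\<in>S. of_int (c s) * s)" using assms(2) by (auto simp: int_span_def)
  have "z * x = (\<Sum>s\<in>S. of_int (c s) * (z * s))"
    by (simp add: x sum_distrib_left mult.left_commute)
  then show ?thesis using assms(1) by (auto intro!: int_span_sum int_span_scale)
qed

text \<open>A multiplier of a finitely generated \<open>\<int>\<close>-module is an eigenvalue of an integer matrix.\<close>

lemma algebraic_int_if_stabilizes_int_span:
  fixes z :: "'a::field_char_0"
  assumes fin: "finite S" and one: "1 \<in> S" and stab: "\<And>s. s \<in> S \<Longrightarrow> z * s \<in> int_span S"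
  shows "algebraic_int z"
proof -
  obtain xs where xs: "set xs = S" "distinct xs" using finite_distinct_list[OF fin] by blast
  define n where "n = length xs"
  have bij: "bij_betw (nth xs) {..<n} S"
    using xs bij_betw_nth[of xs "{..<n}" S] by (simp add: n_def)
  have "\<forall>s\<in>S. \<exists>c. z * s = (\<Sum>t\<in>S. of_int (c t) * t)"
    using stab by (auto simp: int_span_def)
  then obtain c where c: "\<And>s. s \<in> S \<Longrightarrow> z * s = (\<Sum>t\<in>S. of_int (c s t) * t)"
    by metis
  define M :: "int mat" where "M = mat n n (\<lambda>(i,j). c (xs ! i) (xs ! j))"
  define v :: "'a vec" where "v = vec n (nth xs)"
  have M: "M \<in> carrier_mat n n" and M': "map_mat of_int M \<in> carrier_mat n n" by (auto simp: M_def)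
  have "map_mat of_int M *\<^sub>v v = z \<cdot>\<^sub>v v"
  proof (rule eq_vecI)
    fix i assume i: "i < dim_vec (z \<cdot>\<^sub>v v)"
    then have i: "i < n" by (simp add: v_def)
    then have mem: "xs ! i \<in> S" using xs by (auto simp: n_def)
    have "(map_mat of_int M *\<^sub>v v) $ i = (\<Sum>j<n. of_int (c (xs ! i) (xs ! j)) * xs ! j)"
      using i by (simp add: M_def v_def scalar_prod_def row_def atLeast0LessThan)
    also have "\<dots> = (\<Sum>t\<in>S. of_int (c (xs ! i) t) * t)"
      by (rule sum.reindex_bij_betw[OF bij])
    also have "\<dots> = z * xs ! i" using c[OF mem] by simp
    finally show "(map_mat of_int M *\<^sub>v v) $ i = (z \<cdot>\<^sub>v v) $ i"
      using i by (simp add: v_def)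
  qed (auto simp: M_def v_def)
  \<comment> \<open>The vector is nonzero because 1 is one of its entries.\<close>
  moreover have "v \<noteq> 0\<^sub>v n"
  proof
    assume *: "v = 0\<^sub>v n"
    obtain i where "i < n" "xs ! i = 1" using one xs by (metis in_set_conv_nth n_def)
    then show False using arg_cong[OF *, of "\<lambda>w. w $ i"] by (simp add: v_def)
  qed
  ultimately have "eigenvalue (map_mat of_int M) z"
    unfolding eigenvalue_def eigenvector_def using M by (auto simp: v_def intro!: exI[of _ v])
  then have "poly (char_poly (map_mat of_int M)) z = 0"
    using eigenvalue_root_char_poly[OF M'] by blast
  then have "poly (map_poly of_int (char_poly M)) z = 0"
    by (simp add: of_int_hom.char_poly_hom[OF M])
  then show ?thesis
    using degree_monic_char_poly[OF M] by (auto simp: algebraic_int_altdef_ipoly)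
qed

lemma algebraic_int_power_reduction:
  fixes x :: "'a::field_char_0"
  assumes "algebraic_int x"
  obtains m c where "m > 0" "x ^ m = (\<Sum>i<m. of_int (c i) * x ^ i)"
proof -
  obtain p :: "int poly" where p: "poly (map_poly of_int p) x = 0" "lead_coeff p = 1"
    using assms by (auto simp: algebraic_int_altdef_ipoly)
  \<comment> \<open>A constant monic polynomial is 1 and has no root. Positivity of \<open>m\<close>
    later puts the monomial 1 into the spanning set.\<close>
  have "degree p > 0"
  proof (rule ccontr)
    assume "\<not> degree p > 0"
    then obtain k where "p = [:k:]" by (metis degree_eq_zeroE gr0I)
    with p show False by auto
  qed
  moreover have "0 = (\<Sum>i\<le>degree p. of_int (coeff p i) * x ^ i)"
    using p(1) by (simp add: poly_altdef degree_map_poly coeff_map_poly)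
  then have "x ^ degree p = (\<Sum>i<degree p. of_int (- coeff p i) * x ^ i)"
    using p(2) by (simp add: lessThan_Suc_atMost[symmetric] sum_negf eq_neg_iff_add_eq_0 add.commute)
  ultimately show ?thesis by (intro that[of "degree p" "\<lambda>i. - coeff p i"])
qed

text \<open>The monomials \<open>x ^ i * y ^ j\<close> with exponents below the degrees of the two
  monic relations span a finitely generated group stable under \<open>x\<close> and
  \<open>y\<close>: a power that overflows is rewritten by its relation. Sum and product then
  stabilise this group as well.\<close>

lemma algebraic_int_add_mult:
  fixes x y :: "'a::field_char_0"
  assumes "algebraic_int x" "algebraic_int y"
  shows "algebraic_int (x + y)" "algebraic_int (x * y)"
proof -
  obtain m c where m: "m > 0" "x ^ m = (\<Sum>i<m. of_int (c i) * x ^ i)"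
    using algebraic_int_power_reduction[OF assms(1)] by blast
  obtain n d where n: "n > 0" "y ^ n = (\<Sum>i<n. of_int (d i) * y ^ i)"
    using algebraic_int_power_reduction[OF assms(2)] by blast
  define S where "S = (\<lambda>(i,j). x ^ i * y ^ j) ` ({..<m} \<times> {..<n})"
  have fin: "finite S" by (simp add: S_def)
  have S: "x ^ i * y ^ j \<in> int_span S" if "i < m" "j < n" for i j
    by (rule int_span_base[OF fin]) (use that in \<open>auto simp: S_def\<close>)
  have X: "x * s \<in> int_span S" if sS: "s \<in> S" for s
  proof -
    obtain i j where ij: "i < m" "j < n" "s = x ^ i * y ^ j" using sS by (auto simp: S_def)
    show ?thesis
    proof (cases "Suc i < m")
      case True
      then show ?thesis using S[of "Suc i" j] ij by (simp add: mult.assoc)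
    next
      case False
      then have "x * s = x ^ m * y ^ j" using ij by (metis Suc_lessI mult.assoc power_Suc)
      also have "\<dots> = (\<Sum>i<m. of_int (c i) * (x ^ i * y ^ j))"
        by (simp add: m(2) sum_distrib_right mult.assoc)
      also have "\<dots> \<in> int_span S" using ij by (auto intro!: int_span_sum int_span_scale S)
      finally show ?thesis .
    qed
  qed
  have Y: "y * s \<in> int_span S" if sS: "s \<in> S" for s
  proof -
    obtain i j where ij: "i < m" "j < n" "s = x ^ i * y ^ j" using sS by (auto simp: S_def)
    show ?thesis
    proof (cases "Suc j < n")
      case True
      then show ?thesis using S[of i "Suc j"] ij by (simp add: mult.left_commute)
    next
      case False
      then have "y * s = x ^ i * y ^ n" using ij by (metis Suc_lessI mult.left_commute power_Suc)
      also have "\<dots> = (\<Sum>j<n. of_int (d j) * (x ^ i * y ^ j))"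
        by (simp add: n(2) sum_distrib_left mult.left_commute)
      also have "\<dots> \<in> int_span S" using ij by (auto intro!: int_span_sum int_span_scale S)
      finally show ?thesis .
    qed
  qed
  have one: "1 \<in> S" using m n by (force simp: S_def intro!: image_eqI[of _ _ "(0,0)"])
  show "algebraic_int (x + y)"
    by (rule algebraic_int_if_stabilizes_int_span[OF fin one])
       (auto simp: distrib_right intro!: int_span_add X Y)
  show "algebraic_int (x * y)"
    by (rule algebraic_int_if_stabilizes_int_span[OF fin one])
       (auto simp: mult.assoc intro: int_span_mult[of S x, OF X Y])
qed

lemmas algebraic_int_add = algebraic_int_add_mult(1)
lemmas algebraic_int_mult = algebraic_int_add_mult(2)

lemma algebraic_int_diff:
  "algebraic_int x \<Longrightarrow> algebraic_int y \<Longrightarrow> algebraic_int (x - y :: 'a::field_char_0)"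
  using algebraic_int_add[of x "- y"] by simp

lemma algebraic_int_power: "algebraic_int x \<Longrightarrow> algebraic_int (x ^ n :: 'a::field_char_0)"
  by (induction n) (auto intro: algebraic_int_mult)

lemma algebraic_int_prod_list:
  "(\<And>x. x \<in> set xs \<Longrightarrow> algebraic_int x) \<Longrightarrow> algebraic_int (prod_list xs :: 'a::field_char_0)"
  by (induction xs) (auto intro: algebraic_int_mult)

interpretation of_rat_poly_hom: map_poly_comm_ring_hom "of_rat :: rat \<Rightarrow> 'a::field_char_0" ..

text \<open>By reciprocity of the resultant, the Euclidean algorithm computes it within \<open>\<rat>\<close>.\<close>

lemma prod_roots_rat_poly_in_Rats:
  fixes p q :: "rat poly" and as :: "complex list"
  assumes "p \<noteq> 0" "map_poly of_rat p = Polynomial.smult c (\<Prod>a\<leftarrow>as. [:-a, 1:])"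
  shows "(\<Prod>a\<leftarrow>as. poly (map_poly of_rat q) a) \<in> \<rat>"
  using assms
proof (induction "degree p" arbitrary: p q c as rule: less_induct)
  case less
  have c0: "c \<noteq> 0" using less.prems by auto
  have "degree (map_poly of_rat p :: complex poly) = length as"
    using c0 by (simp add: less.prems(2) degree_linear_factors)
  then have len: "length as = degree p" by simp
  \<comment> \<open>The linear factors are monic, so \<open>c\<close> is the rational leading
    coefficient of \<open>p\<close>; the last step divides by a power of it.\<close>
  have lc: "c = of_rat (lead_coeff p)"
  proof -
    have "coeff (map_poly of_rat p :: complex poly) (degree p) = c * lead_coeff (\<Prod>a\<leftarrow>as. [:-a, 1:])"
      by (simp add: less.prems(2) degree_linear_factors len)
    also have "lead_coeff (\<Prod>a\<leftarrow>as. [:-a, 1:]) = 1"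
      by (induction as) (auto simp: lead_coeff_mult simp del: mult_pCons_left)
    finally show ?thesis by (simp add: coeff_map_poly)
  qed
  define r where "r = q mod p"
  have root: "poly (map_poly of_rat p) a = (0::complex)" if "a \<in> set as" for a
    using that by (auto simp: less.prems(2) poly_prod_list prod_list_zero_iff)
  have qr: "poly (map_poly of_rat q) a = poly (map_poly of_rat r) a" if "a \<in> set as" for a
  proof -
    have "map_poly of_rat q = (map_poly of_rat (p * (q div p) + r) :: complex poly)" by (simp add: r_def)
    also have "\<dots> = map_poly of_rat p * map_poly of_rat (q div p) + map_poly of_rat r"
      by (simp only: of_rat_poly_hom.hom_add of_rat_poly_hom.hom_mult)
    finally show ?thesis using root[OF that] by simp
  qed
  have eq: "(\<Prod>a\<leftarrow>as. poly (map_poly of_rat q) a) = (\<Prod>a\<leftarrow>as. poly (map_poly of_rat r) a)"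
    using qr by (intro arg_cong[of _ _ prod_list] map_cong) auto
  show ?case
  proof (cases "as = [] \<or> r = 0")
    case True
    then show ?thesis unfolding eq by (cases as) auto
  next
    case False
    then have deg: "degree r < degree p" "r \<noteq> 0" using less.prems(1) degree_mod_less[of p q] len
      by (auto simp: r_def)
    obtain bs where bs: "Polynomial.smult (lead_coeff (map_poly of_rat r)) (\<Prod>b\<leftarrow>bs. [:-b, 1:]) = (map_poly of_rat r :: complex poly)"
      using fundamental_theorem_algebra_factorized by blast
    define l where "l = (lead_coeff (map_poly of_rat r) :: complex)"
    have l: "l \<in> \<rat>" by (simp add: l_def coeff_map_poly)
    have r: "map_poly of_rat r = Polynomial.smult l (\<Prod>b\<leftarrow>bs. [:-b, 1:])" using bs by (simp add: l_def)
    \<comment> \<open>Roles exchanged: \<open>r\<close> with its roots \<open>bs\<close> replaces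
      \<open>p\<close>, and \<open>p\<close> becomes the polynomial that is evaluated.\<close>
    have IH: "(\<Prod>b\<leftarrow>bs. poly (map_poly of_rat p) b) \<in> \<rat>"
      by (rule less.hyps[OF deg r])
    \<comment> \<open>Both products are powers of leading coefficients times the double product of
      root differences; exchanging the two lists of roots affects only its sign.\<close>
    have swap: "(\<Prod>a\<leftarrow>as. \<Prod>b\<leftarrow>bs. (a - b)) = (-1) ^ (length as * length bs) * (\<Prod>b\<leftarrow>bs. \<Prod>a\<leftarrow>as. (b - a))"
      for as bs :: "complex list"
    proof (induction as)
      case Nil
      show ?case by (simp add: prod_list_replicate map_replicate_const)
    next
      case (Cons x as)
      have "(\<Prod>b\<leftarrow>bs. (x - b)) = (-1) ^ length bs * (\<Prod>b\<leftarrow>bs. (b - x))"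
        by (induction bs) (auto simp: algebra_simps)
      moreover have "(\<Prod>b\<leftarrow>bs. (b - x) * (\<Prod>a\<leftarrow>as. b - a)) = (\<Prod>b\<leftarrow>bs. (b - x)) * (\<Prod>b\<leftarrow>bs. \<Prod>a\<leftarrow>as. b - a)"
        by (induction bs) auto
      ultimately show ?case by (simp add: Cons.IH power_add)
    qed
    have cp: "(\<Prod>b\<leftarrow>bs. poly (map_poly of_rat p) b) = c ^ length bs * (\<Prod>b\<leftarrow>bs. \<Prod>a\<leftarrow>as. (b - a))"
      unfolding less.prems(2) by (induction bs) (auto simp: poly_prod_list o_def)
    have "(\<Prod>a\<leftarrow>as. poly (map_poly of_rat r) a) = l ^ length as * (\<Prod>a\<leftarrow>as. \<Prod>b\<leftarrow>bs. (a - b))"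
      unfolding r by (induction as) (auto simp: poly_prod_list o_def)
    also have "\<dots> = l ^ length as * ((-1) ^ (length as * length bs) * ((\<Prod>b\<leftarrow>bs. poly (map_poly of_rat p) b) / c ^ length bs))"
      unfolding swap[where as = as and bs = bs] cp using c0 by simp
    also have "\<dots> \<in> \<rat>"
      using l IH lc by (intro Rats_mult Rats_power Rats_divide) auto
    finally show ?thesis unfolding eq .
  qed
qed

section \<open>Subfields of the reals and their embeddings\<close>

lemma subfieldD:
  assumes "is_subfield F"
  shows "0 \<in> F" "1 \<in> F"
    and "\<And>x y. x \<in> F \<Longrightarrow> y \<in> F \<Longrightarrow> x + y \<in> F"
    and "\<And>x y. x \<in> F \<Longrightarrow> y \<in> F \<Longrightarrow> x * y \<in> F"
    and "\<And>x. x \<in> F \<Longrightarrow> - x \<in> F"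
    and "\<And>x. x \<in> F \<Longrightarrow> inverse x \<in> F"
  using assms by (auto simp: is_subfield_def)

lemma subfield_diff: "is_subfield F \<Longrightarrow> x \<in> F \<Longrightarrow> y \<in> F \<Longrightarrow> x - y \<in> F"
  using subfieldD(3)[of F x "- y"] subfieldD(5)[of F y] by simp

lemma subfield_divide: "is_subfield F \<Longrightarrow> x \<in> F \<Longrightarrow> y \<in> F \<Longrightarrow> x / y \<in> F"
  using subfieldD(4)[of F x "inverse y"] subfieldD(6)[of F y] by (simp add: divide_inverse)

lemma subfield_power: "is_subfield F \<Longrightarrow> x \<in> F \<Longrightarrow> x ^ n \<in> F"
  by (induction n) (auto intro: subfieldD)

lemma subfield_prod: "is_subfield F \<Longrightarrow> (\<And>i. i \<in> I \<Longrightarrow> f i \<in> F) \<Longrightarrow> prod f I \<in> F"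
  by (induction I rule: infinite_finite_induct) (auto intro: subfieldD)

lemma subfield_sum: "is_subfield F \<Longrightarrow> (\<And>i. i \<in> I \<Longrightarrow> f i \<in> F) \<Longrightarrow> sum f I \<in> F"
  by (induction I rule: infinite_finite_induct) (auto intro: subfieldD)

lemma subfield_of_int: "is_subfield F \<Longrightarrow> of_int n \<in> F"
proof -
  assume F: "is_subfield F"
  have nat: "of_nat m \<in> F" for m by (induction m) (auto intro: subfieldD[OF F])
  show ?thesis by (cases n) (auto intro: nat subfieldD[OF F] simp del: of_nat_Suc)
qed

lemma subfield_Rats: "is_subfield F \<Longrightarrow> \<rat> \<subseteq> F"
  by (auto elim!: Rats_cases' intro: subfield_divide subfield_of_int)

lemma subfield_numeral: "is_subfield F \<Longrightarrow> numeral n \<in> F"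
  using subfield_of_int[of F "numeral n"] by simp

lemmas subfield_intros = subfieldD subfield_diff subfield_divide subfield_power subfield_numeral

lemma is_subfield_Rats: "is_subfield \<rat>"
  by (auto simp: is_subfield_def)

lemma is_subfield_gen_field: "is_subfield (gen_field X)"
  by (auto simp: gen_field_def is_subfield_def)

lemma gen_field_base: "x \<in> X \<Longrightarrow> x \<in> gen_field X"
  by (auto simp: gen_field_def)

lemma gen_field_least: "is_subfield F \<Longrightarrow> X \<subseteq> F \<Longrightarrow> gen_field X \<subseteq> F"
  by (auto simp: gen_field_def)

lemma gen_field_empty: "gen_field {} = \<rat>"
  using gen_field_least[OF is_subfield_Rats, of "{}"] subfield_Rats[OF is_subfield_gen_field, of "{}"]
  by auto

lemma hom_onD:
  assumes F: "is_subfield F" and h: "hom_on F \<phi>"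
  shows "\<phi> 0 = 0" "\<phi> 1 = 1"
    and "\<And>x y. x \<in> F \<Longrightarrow> y \<in> F \<Longrightarrow> \<phi> (x + y) = \<phi> x + \<phi> y"
    and "\<And>x y. x \<in> F \<Longrightarrow> y \<in> F \<Longrightarrow> \<phi> (x * y) = \<phi> x * \<phi> y"
    and "\<And>x. x \<in> F \<Longrightarrow> \<phi> (- x) = - \<phi> x"
    and "\<And>x y. x \<in> F \<Longrightarrow> y \<in> F \<Longrightarrow> \<phi> (x - y) = \<phi> x - \<phi> y"
    and "\<And>x n. x \<in> F \<Longrightarrow> \<phi> (x ^ n) = \<phi> x ^ n"
    and "\<And>n. \<phi> (of_int n) = of_int n"
    and "\<And>x y. x \<in> F \<Longrightarrow> y \<in> F \<Longrightarrow> y \<noteq> 0 \<Longrightarrow> \<phi> (x / y) = \<phi> x / \<phi> y"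
    and "\<And>x. x \<in> F \<Longrightarrow> \<phi> x = 0 \<longleftrightarrow> x = 0"
proof -
  note sf = subfieldD[OF F]
  show one: "\<phi> 1 = 1" and add: "\<And>x y. x \<in> F \<Longrightarrow> y \<in> F \<Longrightarrow> \<phi> (x + y) = \<phi> x + \<phi> y"
    and mult: "\<And>x y. x \<in> F \<Longrightarrow> y \<in> F \<Longrightarrow> \<phi> (x * y) = \<phi> x * \<phi> y"
    using h by (auto simp: hom_on_def)
  show zero: "\<phi> 0 = 0" using add[of 0 0] sf(1) by (metis add.right_neutral add_cancel_right_right)
  show minus: "\<phi> (- x) = - \<phi> x" if "x \<in> F" for x
    using add[of x "- x"] sf that zero by (simp add: eq_neg_iff_add_eq_0 add.commute)
  show "\<phi> (x - y) = \<phi> x - \<phi> y" if "x \<in> F" "y \<in> F" for x y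
    using add[of x "- y"] sf that minus by simp
  show "\<phi> (x ^ n) = \<phi> x ^ n" if "x \<in> F" for x n
    by (induction n) (use that in \<open>auto simp: one mult subfield_power[OF F]\<close>)
  have nat: "\<phi> (of_nat m) = of_nat m" for m
    by (induction m) (use subfield_of_int[OF F, of "int _"] in \<open>auto simp: one zero add sf\<close>)
  show "\<phi> (of_int n) = of_int n" for n
  proof (cases n)
    case (nonneg m) then show ?thesis by (simp add: nat)
  next
    case (neg m)
    then have "\<phi> (of_int n) = \<phi> (- of_nat (Suc m))" by simp
    also have "\<dots> = - \<phi> (of_nat (Suc m))"
      using subfield_of_int[OF F, of "int (Suc m)"] by (intro minus) (simp only: of_int_of_nat_eq)
    also have "\<dots> = of_int n" unfolding nat neg by simp
    finally show ?thesis .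
  qed
  \<comment> \<open>A nonzero element has an invertible image, which yields both the quotient rule
    and injectivity.\<close>
  have inv: "\<phi> y * \<phi> (inverse y) = 1" if "y \<in> F" "y \<noteq> 0" for y
    using mult[of y "inverse y"] that sf one by simp
  show "\<phi> (x / y) = \<phi> x / \<phi> y" if "x \<in> F" "y \<in> F" "y \<noteq> 0" for x y
  proof -
    have "\<phi> (x / y) = \<phi> x * \<phi> (inverse y)" using mult[of x "inverse y"] that sf by (simp add: divide_inverse)
    then show ?thesis using inv[OF that(2,3)] by (metis inverse_unique divide_inverse)
  qed
  show "\<phi> x = 0 \<longleftrightarrow> x = 0" if "x \<in> F" for x
    using inv[OF that] zero by (metis mult_zero_left zero_neq_one)
qed

lemma hom_on_numeral:
  assumes "is_subfield F" "hom_on F \<phi>"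
  shows "\<phi> (numeral n) = numeral n"
  using hom_onD(8)[OF assms, of "numeral n"] by simp

lemma hom_on_Rats:
  fixes \<phi> :: "real \<Rightarrow> 'a::field_char_0"
  assumes F: "is_subfield F" and h: "hom_on F \<phi>"
  shows "\<phi> (of_rat r) = of_rat r"
proof (cases r)
  case (Fract a b)
  then show ?thesis using hom_onD(8,9)[OF F h] subfield_of_int[OF F]
    by (simp add: of_rat_rat)
qed

text \<open>Evaluation of integer polynomials commutes with \<open>\<phi>\<close>, so
  \<open>\<phi> x\<close> is a root of the same monic polynomial.\<close>

lemma hom_on_algebraic_int:
  fixes \<phi> :: "real \<Rightarrow> 'a::field_char_0"
  assumes F: "is_subfield F" and h: "hom_on F \<phi>" and x: "x \<in> F" "algebraic_int x"
  shows "algebraic_int (\<phi> x)"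
proof -
  obtain p :: "int poly" where p: "poly (map_poly of_int p) x = 0" "lead_coeff p = 1"
    using x by (auto simp: algebraic_int_altdef_ipoly)
  have ev: "poly (map_poly of_int q) x \<in> F \<and>
      \<phi> (poly (map_poly of_int q) x) = poly (map_poly of_int q) (\<phi> x)" for q
  proof (induction q)
    case 0
    show ?case using hom_onD(1)[OF F h] subfieldD[OF F] by simp
  next
    case (pCons a q)
    then show ?case using x subfield_of_int[OF F]
      by (simp add: map_poly_pCons hom_onD[OF F h] subfieldD[OF F])
  qed
  show ?thesis using ev[of p] p hom_onD(1)[OF F h] by (auto simp: algebraic_int_altdef_ipoly)
qed

lemma hom_on_subset: "hom_on K \<phi> \<Longrightarrow> L \<subseteq> K \<Longrightarrow> hom_on L \<phi>"
  unfolding hom_on_def by blast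

section \<open>Norms and dimension over the rationals\<close>

interpretation rat_real: vector_space "\<lambda>(r::rat) (x::real). of_rat r * x"
  by unfold_locales (auto simp: algebra_simps of_rat_add of_rat_mult)

text \<open>The exchange lemma in the vector space \<open>rat_real\<close>. Through it the length of
  a list of embeddings will limit the degree.\<close>

lemma card_le_of_lin_indep_Rats:
  assumes "finite S" "finite B" "lin_indep_over \<rat> B" "B \<subseteq> rat_real.span S"
  shows "card B \<le> card S"
proof -
  have "rat_real.independent B"
  proof (rule rat_real.independent_if_scalars_zero[OF assms(2)])
    fix f x assume "(\<Sum>x\<in>B. of_rat (f x) * x) = 0" "x \<in> B"
    then show "f x = 0" using assms(3) unfolding lin_indep_over_def
      by (metis Rats_of_rat of_rat_eq_0_iff)
  qed
  then show ?thesis using rat_real.independent_span_bound[OF assms(1)] assms(4) by blast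
qed

text \<open>\<open>\<Phi>\<close> lists the non-identical embeddings of the number field \<open>K\<close>; repetitions are harmless,
  all that is needed is that norms are rational and that \<open>[K : \<rat>] \<le> length \<Phi> + 1\<close>.\<close>

definition norm_family :: "real set \<Rightarrow> (real \<Rightarrow> complex) list \<Rightarrow> bool" where
  "norm_family K \<Phi> \<longleftrightarrow> is_subfield K \<and>
     (\<forall>\<phi>\<in>set \<Phi>. hom_on K \<phi> \<and> (\<exists>x\<in>K. \<phi> x \<noteq> of_real x)) \<and>
     (\<forall>x\<in>K. of_real x * (\<Prod>\<phi>\<leftarrow>\<Phi>. \<phi> x) \<in> \<rat>) \<and>
     (\<exists>S. finite S \<and> card S \<le> Suc (length \<Phi>) \<and> K \<subseteq> rat_real.span S)"

text \<open>All images of \<open>h\<close> are algebraic integers and embeddings are injective, so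
  the rational number \<open>N\<close> is a nonzero integer. As \<open>\<rho> \<le> 1\<close>,
  additional embeddings can only lower the bound on its absolute value.\<close>

lemma norm_family_length_less:
  assumes fam: "norm_family K \<Phi>" and h: "h \<in> K" "algebraic_int h" "h \<noteq> 0"
    and id: "\<bar>h\<bar> \<le> R" and \<rho>: "0 \<le> \<rho>" "\<rho> \<le> 1" "R * \<rho> ^ D < 1"
    and bnd: "\<And>\<phi>. \<phi> \<in> set \<Phi> \<Longrightarrow> cmod (\<phi> h) \<le> \<rho>"
  shows "length \<Phi> < D"
proof (rule ccontr)
  assume "\<not> length \<Phi> < D"
  have K: "is_subfield K" and hom: "\<And>\<phi>. \<phi> \<in> set \<Phi> \<Longrightarrow> hom_on K \<phi>"
    using fam by (auto simp: norm_family_def)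
  define N where "N = of_real h * (\<Prod>\<phi>\<leftarrow>\<Phi>. \<phi> h)"
  have "algebraic_int N" unfolding N_def
    using h hom_on_algebraic_int[OF K hom h(1,2)]
    by (auto intro!: algebraic_int_mult algebraic_int_prod_list)
  moreover have "N \<in> \<rat>" using fam h by (auto simp: norm_family_def N_def)
  ultimately have "N \<in> \<int>" by (rule rational_algebraic_int_is_int)
  moreover have "N \<noteq> 0" unfolding N_def
    using h hom_onD(10)[OF K hom h(1)] by (auto simp: prod_list_zero_iff)
  ultimately have "1 \<le> cmod N" by (auto elim!: Ints_cases)
  have "cmod (\<Prod>\<phi>\<leftarrow>\<Phi>. \<phi> h) \<le> \<rho> ^ length \<Phi>" using bnd \<rho>(1)
    by (induction \<Phi>) (auto simp: norm_mult intro!: mult_mono)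
  also have "\<dots> \<le> \<rho> ^ D" using \<open>\<not> length \<Phi> < D\<close> \<rho> by (intro power_decreasing) auto
  finally have "cmod N \<le> R * \<rho> ^ D"
    unfolding N_def norm_mult using id by (intro mult_mono) auto
  then show False using \<open>1 \<le> cmod N\<close> \<rho> by linarith
qed

section \<open>Adjoining a square root to a subfield\<close>

definition adjoin :: "real set \<Rightarrow> real \<Rightarrow> real set" where
  "adjoin K r = {x + y * r | x y. x \<in> K \<and> y \<in> K}"

lemma adjoinI: "x \<in> K \<Longrightarrow> y \<in> K \<Longrightarrow> x + y * r \<in> adjoin K r"
  by (auto simp: adjoin_def)

text \<open>Linear independence of 1 and \<open>r\<close>: different coefficients of
  \<open>r\<close> would exhibit \<open>r\<close> as a quotient of elements of
  \<open>K\<close>.\<close>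

lemma adjoin_unique:
  assumes K: "is_subfield K" and r: "r \<notin> K" and mem: "x \<in> K" "y \<in> K" "x' \<in> K" "y' \<in> K"
    and eq: "x + y * r = x' + y' * r"
  shows "x = x'" "y = y'"
proof -
  show "y = y'"
  proof (rule ccontr)
    assume "y \<noteq> y'"
    then have "r = (x' - x) / (y - y')" using eq by (simp add: field_simps)
    then show False using r mem by (auto intro: subfield_intros[OF K])
  qed
  then show "x = x'" using eq by simp
qed

lemma subset_adjoin: "is_subfield K \<Longrightarrow> K \<subseteq> adjoin K r"
  using adjoinI[of _ K 0 r] by (auto intro: subfieldD)

lemma root_mem_adjoin: "is_subfield K \<Longrightarrow> r \<in> adjoin K r"
  using adjoinI[of 0 K 1 r] by (auto intro: subfieldD)

lemma adjoin_least: "is_subfield F \<Longrightarrow> K \<subseteq> F \<Longrightarrow> r \<in> F \<Longrightarrow> adjoin K r \<subseteq> F"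
  by (auto simp: adjoin_def intro!: subfieldD)

text \<open>Products stay inside since \<open>r * r\<close> is in \<open>K\<close>, and inverses
  arise by rationalising the denominator. If \<open>r\<close> already lies in \<open>K\<close>, the
  set collapses to \<open>K\<close>.\<close>

lemma is_subfield_adjoin:
  assumes K: "is_subfield K" and r2: "r * r \<in> K"
  shows "is_subfield (adjoin K r)"
proof (cases "r \<in> K")
  case True
  then have "adjoin K r = K" using adjoin_least[OF K order_refl] subset_adjoin[OF K] by auto
  then show ?thesis using K by simp
next
  case False
  have mult: "(x + y * r) * (x' + y' * r) \<in> adjoin K r"
    if "x \<in> K" "y \<in> K" "x' \<in> K" "y' \<in> K" for x y x' y'
  proof -
    have "(x + y * r) * (x' + y' * r) = (x * x' + y * y' * (r * r)) + (x * y' + y * x') * r"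
      by (simp add: algebra_simps)
    also have "\<dots> \<in> adjoin K r" using that r2 by (intro adjoinI) (auto intro: subfield_intros[OF K])
    finally show ?thesis .
  qed
  have inv: "inverse (x + y * r) \<in> adjoin K r" if xy: "x \<in> K" "y \<in> K" for x y
  proof (cases "x + y * r = 0")
    case True
    then show ?thesis using subset_adjoin[OF K, of r] subfieldD[OF K] by auto
  next
    case ne: False
    \<comment> \<open>The relative norm of \<open>x + y * r\<close>. The conjugate
      \<open>x - y * r\<close> is nonzero because 1 and \<open>r\<close> are independent over
      \<open>K\<close>.\<close>
    define n where "n = x * x - y * y * (r * r)"
    have "x - y * r \<noteq> 0"
    proof
      assume "x - y * r = 0"
      then have "x = 0 \<and> y = 0" using adjoin_unique[OF K False, of x "- y" 0 0] xy subfieldD[OF K] by auto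
      then show False using ne by simp
    qed
    moreover have n: "n = (x + y * r) * (x - y * r)" by (simp add: n_def algebra_simps)
    ultimately have "inverse (x + y * r) = (x - y * r) / n"
      using ne by (simp add: divide_simps)
    also have "\<dots> = x / n + (- y / n) * r" by (simp add: diff_divide_distrib)
    also have "\<dots> \<in> adjoin K r" using xy r2
      by (intro adjoinI) (auto simp: n_def intro!: subfield_intros[OF K])
    finally show ?thesis .
  qed
  have add: "(x + y * r) + (x' + y' * r) \<in> adjoin K r"
    if "x \<in> K" "y \<in> K" "x' \<in> K" "y' \<in> K" for x y x' y'
    using adjoinI[of "x + x'" K "y + y'" r] that subfieldD[OF K] by (simp add: algebra_simps)
  have minus: "- (x + y * r) \<in> adjoin K r" if "x \<in> K" "y \<in> K" for x y
    using adjoinI[of "- x" K "- y" r] that subfieldD[OF K] by (simp add: algebra_simps)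
  have "a + b \<in> adjoin K r \<and> - a \<in> adjoin K r \<and> a * b \<in> adjoin K r \<and> inverse a \<in> adjoin K r"
    if ab: "a \<in> adjoin K r" "b \<in> adjoin K r" for a b
  proof -
    obtain x y x' y' where "x \<in> K" "y \<in> K" "x' \<in> K" "y' \<in> K" "a = x + y * r" "b = x' + y' * r"
      using ab unfolding adjoin_def by blast
    then show ?thesis by (metis add minus mult inv)
  qed
  then show ?thesis unfolding is_subfield_def
    using subset_adjoin[OF K, of r] subfieldD(1,2)[OF K] by blast
qed

text \<open>The coordinates picked by \<open>SOME\<close> are the only ones when \<open>r\<close> is
  not in \<open>K\<close>. Here \<open>\<rho>\<close> is the intended image of \<open>r\<close>;
  multiplicativity will require it to be a square root of the image of \<open>r * r\<close>.\<close>

definition extend_hom :: "real set \<Rightarrow> real \<Rightarrow> (real \<Rightarrow> complex) \<Rightarrow> complex \<Rightarrow> real \<Rightarrow> complex" where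
  "extend_hom K r \<phi> \<rho> z =
     (let p = SOME (x, y). x \<in> K \<and> y \<in> K \<and> z = x + y * r in \<phi> (fst p) + \<phi> (snd p) * \<rho>)"

lemma extend_hom_eq:
  assumes "is_subfield K" "r \<notin> K" "x \<in> K" "y \<in> K"
  shows "extend_hom K r \<phi> \<rho> (x + y * r) = \<phi> x + \<phi> y * \<rho>"
proof -
  have "(SOME (x', y'). x' \<in> K \<and> y' \<in> K \<and> x + y * r = x' + y' * r) = (x, y)"
  proof (rule some_equality)
    fix p assume p: "case p of (x', y') \<Rightarrow> x' \<in> K \<and> y' \<in> K \<and> x + y * r = x' + y' * r"
    then have "fst p \<in> K" "snd p \<in> K" "x + y * r = fst p + snd p * r" by (auto split: prod.splits)
    from adjoin_unique[OF assms(1-4) this] show "p = (x, y)" by (simp add: prod_eq_iff)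
  qed (use assms in auto)
  then show ?thesis by (simp add: extend_hom_def)
qed

lemma extend_hom_base:
  assumes "is_subfield K" "r \<notin> K" "x \<in> K" "\<phi> 0 = 0"
  shows "extend_hom K r \<phi> \<rho> x = \<phi> x"
  using extend_hom_eq[OF assms(1-3) subfieldD(1)[OF assms(1)], of \<phi> \<rho>] assms(4) by simp

lemma hom_on_extend_hom:
  assumes K: "is_subfield K" and r: "r \<notin> K" "r * r \<in> K" and h: "hom_on K \<phi>" and \<rho>: "\<phi> (r * r) = \<rho> * \<rho>"
  shows "hom_on (adjoin K r) (extend_hom K r \<phi> \<rho>)"
proof -
  note E = extend_hom_eq[OF K r(1)] and H = hom_onD[OF K h] and sf = subfieldD[OF K]
  let ?e = "extend_hom K r \<phi> \<rho>"
  have add: "?e ((x + y * r) + (x' + y' * r)) = ?e (x + y * r) + ?e (x' + y' * r)"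
    if "x \<in> K" "y \<in> K" "x' \<in> K" "y' \<in> K" for x y x' y'
  proof -
    have "(x + y * r) + (x' + y' * r) = (x + x') + (y + y') * r" by (simp add: algebra_simps)
    then show ?thesis using that by (simp only: E H sf) (simp add: algebra_simps)
  qed
  have mult: "?e ((x + y * r) * (x' + y' * r)) = ?e (x + y * r) * ?e (x' + y' * r)"
    if "x \<in> K" "y \<in> K" "x' \<in> K" "y' \<in> K" for x y x' y'
  proof -
    have "(x + y * r) * (x' + y' * r) = (x * x' + y * y' * (r * r)) + (x * y' + y * x') * r"
      by (simp add: algebra_simps)
    then have "?e ((x + y * r) * (x' + y' * r)) = ?e ((x * x' + y * y' * (r * r)) + (x * y' + y * x') * r)"
      by simp
    also have "\<dots> = \<phi> (x * x' + y * y' * (r * r)) + \<phi> (x * y' + y * x') * \<rho>"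
      using that r by (intro E) (auto intro: sf)
    also have "\<dots> = (\<phi> x * \<phi> x' + \<phi> y * \<phi> y' * (\<rho> * \<rho>)) + (\<phi> x * \<phi> y' + \<phi> y * \<phi> x') * \<rho>"
      unfolding \<rho>[symmetric] using that r by (simp only: H sf)
    finally show ?thesis using that by (simp only: E) (simp add: algebra_simps)
  qed
  have "?e 1 = 1" using extend_hom_base[OF K r(1) sf(2)] H by simp
  moreover have "?e (a + b) = ?e a + ?e b \<and> ?e (a * b) = ?e a * ?e b"
    if ab: "a \<in> adjoin K r" "b \<in> adjoin K r" for a b
  proof -
    obtain x y x' y' where "x \<in> K" "y \<in> K" "x' \<in> K" "y' \<in> K" "a = x + y * r" "b = x' + y' * r"
      using ab unfolding adjoin_def by blast
    then show ?thesis by (metis add mult)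
  qed
  ultimately show ?thesis unfolding hom_on_def by blast
qed

text \<open>Every embedding of \<open>K\<close> extends in exactly the two ways given by the sign of
  \<open>r\<close>, and the norm to the rationals is the relative norm to \<open>K\<close> followed
  by the norm of \<open>K\<close>.\<close>

lemma norm_family_adjoin:
  assumes fam: "norm_family K \<Phi>" and r: "r \<notin> K" "r * r \<in> \<rat>"
  shows "\<exists>\<Psi>. norm_family (adjoin K r) \<Psi>"
proof -
  have K: "is_subfield K" and hom: "\<And>\<phi>. \<phi> \<in> set \<Phi> \<Longrightarrow> hom_on K \<phi>"
    and nid: "\<And>\<phi>. \<phi> \<in> set \<Phi> \<Longrightarrow> \<exists>x\<in>K. \<phi> x \<noteq> of_real x"
    and nrm: "\<And>x. x \<in> K \<Longrightarrow> of_real x * (\<Prod>\<phi>\<leftarrow>\<Phi>. \<phi> x) \<in> \<rat>"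
    using fam by (auto simp: norm_family_def)
  obtain S where S: "finite S" "card S \<le> Suc (length \<Phi>)" "K \<subseteq> rat_real.span S"
    using fam by (auto simp: norm_family_def)
  note sf = subfieldD[OF K]
  have r2: "r * r \<in> K" using r subfield_Rats[OF K] by auto
  have r0: "r \<noteq> 0" using r(1) sf by auto
  have idh: "hom_on K complex_of_real" by (auto simp: hom_on_def)
  \<comment> \<open>A rational square is fixed by all embeddings, so \<open>r\<close> and
    \<open>- r\<close> are the admissible images of \<open>r\<close> each time.\<close>
  have fix_r2: "\<phi> (r * r) = of_real r * of_real r" if h: "hom_on K \<phi>" for \<phi> :: "real \<Rightarrow> complex"
  proof -
    obtain q where "r * r = of_rat q" using r(2) by (auto elim: Rats_cases)
    then show ?thesis using hom_on_Rats[OF K h, of q] hom_on_Rats[OF K idh, of q] by (simp flip: of_real_mult)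
  qed
  let ?r = "complex_of_real r"
  let ?e = "extend_hom K r"
  \<comment> \<open>The identity of \<open>K\<close> contributes only the extension with
    \<open>r\<close> sent to \<open>- r\<close>, since the other one is the identity of the larger
    field.\<close>
  define \<Psi> where "\<Psi> = ?e of_real (- ?r) # concat (map (\<lambda>\<phi>. [?e \<phi> ?r, ?e \<phi> (- ?r)]) \<Phi>)"
  have E: "hom_on (adjoin K r) (?e \<phi> ?r)" "hom_on (adjoin K r) (?e \<phi> (- ?r))" if "hom_on K \<phi>" for \<phi>
    using hom_on_extend_hom[OF K r(1) r2 that] fix_r2[OF that] by auto
  have "\<exists>x\<in>adjoin K r. ?e of_real (- ?r) x \<noteq> of_real x"
  proof
    show "r \<in> adjoin K r" by (rule root_mem_adjoin[OF K])
    show "?e of_real (- ?r) r \<noteq> of_real r"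
      using extend_hom_eq[OF K r(1) sf(1,2), of of_real "- ?r"] r0 by simp
  qed
  moreover have "\<exists>x\<in>adjoin K r. ?e \<phi> \<rho> x \<noteq> of_real x" if "\<phi> \<in> set \<Phi>" for \<phi> \<rho>
    using nid[OF that] extend_hom_base[OF K r(1)] hom_onD(1)[OF K hom[OF that]] subset_adjoin[OF K, of r]
    by (metis subsetD)
  ultimately have 1: "\<forall>\<phi>\<in>set \<Psi>. hom_on (adjoin K r) \<phi> \<and> (\<exists>x\<in>adjoin K r. \<phi> x \<noteq> of_real x)"
    using E hom idh by (auto simp: \<Psi>_def)
  have 2: "of_real z * (\<Prod>\<psi>\<leftarrow>\<Psi>. \<psi> z) \<in> \<rat>" if zK: "z \<in> adjoin K r" for z
  proof -
    obtain x y where xy: "x \<in> K" "y \<in> K" and z: "z = x + y * r" using zK by (auto simp: adjoin_def)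
    define n where "n = x * x - y * y * (r * r)"
    have n: "n \<in> K" using xy r2 by (auto simp: n_def intro!: subfield_intros[OF K])
    \<comment> \<open>The two extensions of \<open>\<phi>\<close> multiply to \<open>\<phi>\<close>
      of the relative norm \<open>n\<close>, which reduces the rationality claim to
      \<open>K\<close>.\<close>
    have cj: "?e \<phi> ?r z * ?e \<phi> (- ?r) z = \<phi> n" if h: "hom_on K \<phi>" for \<phi>
    proof -
      have "\<phi> n = \<phi> x * \<phi> x - \<phi> y * \<phi> y * (?r * ?r)"
        unfolding n_def fix_r2[OF h, symmetric] using xy r2 by (simp only: hom_onD[OF K h] sf)
      then show ?thesis using xy unfolding z
        by (simp only: extend_hom_eq[OF K r(1)]) (simp add: algebra_simps)
    qed
    have "(\<Prod>\<psi>\<leftarrow>concat (map (\<lambda>\<phi>. [?e \<phi> ?r, ?e \<phi> (- ?r)]) \<Phi>). \<psi> z) = (\<Prod>\<phi>\<leftarrow>\<Phi>. \<phi> n)"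
      using hom by (induction \<Phi>) (auto simp: cj mult.assoc[symmetric])
    moreover have "?e of_real ?r z = of_real z"
      using xy by (simp add: z extend_hom_eq[OF K r(1)])
    ultimately have "of_real z * (\<Prod>\<psi>\<leftarrow>\<Psi>. \<psi> z) = of_real n * (\<Prod>\<phi>\<leftarrow>\<Phi>. \<phi> n)"
      using cj[OF idh] by (simp add: \<Psi>_def mult.assoc[symmetric])
    then show ?thesis using nrm[OF n] by simp
  qed
  \<comment> \<open>Twice as many generators match the new family, as
    \<open>Suc (length \<Psi>) = 2 * Suc (length \<Phi>)\<close>.\<close>
  define T where "T = S \<union> (\<lambda>s. s * r) ` S"
  have len: "length \<Psi> = Suc (2 * length \<Phi>)" unfolding \<Psi>_def by (induction \<Phi>) auto
  have "card T \<le> card S + card S" unfolding T_def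
    using card_Un_le[of S "(\<lambda>s. s * r) ` S"] card_image_le[OF S(1), of "\<lambda>s. s * r"] by linarith
  then have card: "card T \<le> Suc (length \<Psi>)" using S(2) len by linarith
  have spr: "y * r \<in> rat_real.span T" if "y \<in> rat_real.span S" for y
    using that
  proof (induction rule: rat_real.span_induct_alt)
    case base
    show ?case using rat_real.span_zero by simp
  next
    case (step c x y)
    have "x * r \<in> rat_real.span T" using step by (intro rat_real.span_base) (auto simp: T_def)
    then have "of_rat c * (x * r) + y * r \<in> rat_real.span T"
      using step by (intro rat_real.span_add rat_real.span_scale)
    then show ?case by (simp add: algebra_simps)
  qed
  have "adjoin K r \<subseteq> rat_real.span T"
  proof
    fix z assume "z \<in> adjoin K r"
    then obtain x y where xy: "x \<in> K" "y \<in> K" and z: "z = x + y * r" by (auto simp: adjoin_def)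
    have "x \<in> rat_real.span T" using xy S(3) rat_real.span_mono[of S T] by (auto simp: T_def)
    then show "z \<in> rat_real.span T" unfolding z using spr xy S(3) by (intro rat_real.span_add) auto
  qed
  then show ?thesis using 1 2 card is_subfield_adjoin[OF K r2] S(1)
    unfolding norm_family_def by (intro exI[of _ \<Psi>] conjI exI[of _ T]) (auto simp: T_def)
qed

text \<open>The part of the tower law that is used: 1 and \<open>s\<close> are independent over
  \<open>F0\<close>, so a relation among all \<open>b\<close> and \<open>b * s\<close> is one over
  \<open>F\<close> with coefficients \<open>c b + c (b * s) * s\<close>, and these vanish only if
  both parts do.\<close>

lemma card_double_lin_indep:
  assumes F: "is_subfield F" "F0 \<subseteq> F" "is_subfield F0" "s \<in> F" "s \<notin> F0"
    and B: "finite B" "lin_indep_over F B"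
  shows "lin_indep_over F0 (B \<union> (\<lambda>b. b * s) ` B)" "card (B \<union> (\<lambda>b. b * s) ` B) = 2 * card B"
proof -
  have s0: "s \<noteq> 0" using assms(5) subfieldD[OF F(3)] by auto
  have inj: "inj_on (\<lambda>b. b * s) B" using s0 by (auto simp: inj_on_def)
  have indep: "\<forall>b\<in>B. c b = 0" if "\<forall>b\<in>B. c b \<in> F" "(\<Sum>b\<in>B. c b * b) = 0" for c
    using B(2) that unfolding lin_indep_over_def by blast
  have disj: "B \<inter> (\<lambda>b. b * s) ` B = {}"
  proof (rule ccontr)
    assume "B \<inter> (\<lambda>b. b * s) ` B \<noteq> {}"
    then obtain b where b: "b \<in> B" "b * s \<in> B" by auto
    \<comment> \<open>If \<open>b\<close> and \<open>b * s\<close> were both in \<open>B\<close>,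
      then \<open>s\<close> times the first minus the second would be a relation over
      \<open>F\<close>; its coefficients vanish only for \<open>s\<close> equal to 0 or 1, both of
      which lie in \<open>F0\<close>.\<close>
    define c where "c = (\<lambda>x. (if x = b then s else 0) - (if x = b * s then 1 else 0))"
    have "(\<Sum>x\<in>B. c x * x) = (\<Sum>x\<in>B. if x = b then s * x else 0) - (\<Sum>x\<in>B. if x = b * s then x else 0)"
      unfolding sum_subtractf[symmetric] by (intro sum.cong) (auto simp: c_def algebra_simps)
    also have "\<dots> = 0" using b B(1) by simp
    finally have "\<forall>x\<in>B. c x = 0"
      by (intro indep) (auto simp: c_def intro: subfield_intros[OF F(1)] F)
    then have "c b = 0" using b by blast
    then have "b = b * s" "s = 1 \<or> s = 0" using s0 by (auto simp: c_def split: if_splits)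
    then show False using assms(5) subfieldD[OF F(3)] by auto
  qed
  show "card (B \<union> (\<lambda>b. b * s) ` B) = 2 * card B"
    using card_Un_disjoint[OF B(1) _ disj] B(1) card_image[OF inj] by simp
  show "lin_indep_over F0 (B \<union> (\<lambda>b. b * s) ` B)"
    unfolding lin_indep_over_def
  proof (intro allI impI, elim conjE)
    fix c assume c: "\<forall>b\<in>B \<union> (\<lambda>b. b * s) ` B. c b \<in> F0" "(\<Sum>b\<in>B \<union> (\<lambda>b. b * s) ` B. c b * b) = 0"
    have "0 = (\<Sum>b\<in>B. c b * b) + (\<Sum>b\<in>(\<lambda>b. b * s) ` B. c b * b)"
      using c(2) sum.union_disjoint[OF B(1) finite_imageI[OF B(1)] disj, of "\<lambda>b. c b * b"] by simp
    also have "\<dots> = (\<Sum>b\<in>B. (c b + c (b * s) * s) * b)"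
      by (simp add: sum.reindex[OF inj] sum.distrib[symmetric] algebra_simps)
    finally have "\<forall>b\<in>B. c b + c (b * s) * s = 0"
      using c(1) F by (intro indep) (auto intro!: subfieldD(3,4)[OF F(1)])
    then have "c b = 0 \<and> c (b * s) = 0" if "b \<in> B" for b
      using adjoin_unique[OF F(3) assms(5), of "c b" "c (b * s)" 0 0] that c(1) subfieldD(1)[OF F(3)]
      by (metis UnI1 UnI2 add_0 image_eqI mult_zero_left)
    then show "\<forall>b\<in>B \<union> (\<lambda>b. b * s) ` B. c b = 0" by auto
  qed
qed

section \<open>Bounding the degree of an extension\<close>

lemma span_overI: "(\<And>b. b \<in> B \<Longrightarrow> c b \<in> L) \<Longrightarrow> x = (\<Sum>b\<in>B. c b * b) \<Longrightarrow> x \<in> span_over L B"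
  by (auto simp: span_over_def)

text \<open>\<open>ext_degree\<close> is infinite unless a basis exists, so one has to be produced.
  The bound \<open>m\<close> guarantees an independent set of maximal size, and maximality forces it
  to span.\<close>

lemma ext_degree_leI:
  assumes F: "is_subfield F" "F \<subseteq> K" and K: "is_subfield K"
    and bnd: "\<And>B. finite B \<Longrightarrow> B \<subseteq> K \<Longrightarrow> lin_indep_over F B \<Longrightarrow> card B \<le> m"
  shows "ext_degree F K \<le> enat m"
proof -
  define P where "P = (\<lambda>n. \<exists>B. finite B \<and> B \<subseteq> K \<and> lin_indep_over F B \<and> card B = n)"
  have "P 0" unfolding P_def by (rule exI[of _ "{}"]) (auto simp: lin_indep_over_def)
  moreover have "\<forall>n. P n \<longrightarrow> n \<le> m" using bnd by (auto simp: P_def)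
  ultimately have "P (Greatest P)" and max: "\<And>n. P n \<Longrightarrow> n \<le> Greatest P"
    by (auto intro: GreatestI_nat Greatest_le_nat)
  then obtain B where B: "finite B" "B \<subseteq> K" "lin_indep_over F B" "card B = Greatest P"
    by (auto simp: P_def)
  have indep: "\<forall>b\<in>B. c b = 0" if "\<forall>b\<in>B. c b \<in> F" "(\<Sum>b\<in>B. c b * b) = 0" for c
    using B(3) that unfolding lin_indep_over_def by blast
  have "x \<in> span_over F B" if x: "x \<in> K" for x
  proof (cases "x \<in> B")
    case True
    have "(\<Sum>b\<in>B. (if b = x then 1 else 0) * b) = (\<Sum>b\<in>B. if b = x then b else 0)"
      by (intro sum.cong) auto
    also have "\<dots> = x" using True B(1) by simp
    finally show ?thesis using subfieldD(1,2)[OF F(1)]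
      by (intro span_overI[of B "\<lambda>b. if b = x then 1 else 0"]) auto
  next
    case False
    \<comment> \<open>By maximality \<open>x\<close> enters a nontrivial relation. Its coefficient
      there is nonzero, as \<open>B\<close> alone is independent, so the relation can be solved for
      \<open>x\<close>.\<close>
    have "\<not> lin_indep_over F (insert x B)"
    proof
      assume "lin_indep_over F (insert x B)"
      then have "P (card (insert x B))" unfolding P_def using B(1,2) x by blast
      then show False using max[of "card (insert x B)"] B False by simp
    qed
    then obtain c where c: "\<forall>b\<in>insert x B. c b \<in> F" "(\<Sum>b\<in>insert x B. c b * b) = 0"
      "\<not> (\<forall>b\<in>insert x B. c b = 0)" unfolding lin_indep_over_def by blast
    have sum: "c x * x + (\<Sum>b\<in>B. c b * b) = 0" using c(2) B(1) False by simp
    have "c x \<noteq> 0"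
    proof
      assume cx: "c x = 0"
      then have "\<forall>b\<in>B. c b = 0" using c(1) sum by (intro indep) simp_all
      then show False using c(3) cx by blast
    qed
    have neg: "- (\<Sum>b\<in>B. c b * b) = c x * x" using sum by linarith
    have "(\<Sum>b\<in>B. (- c b / c x) * b) = (\<Sum>b\<in>B. - (c b * b) / c x)"
      by (intro sum.cong refl) (simp only: times_divide_eq_left mult_minus_left)
    also have "\<dots> = - (\<Sum>b\<in>B. c b * b) / c x"
      by (simp only: sum_divide_distrib[symmetric] sum_negf)
    also have "\<dots> = x" unfolding neg using \<open>c x \<noteq> 0\<close> by simp
    finally have "x = (\<Sum>b\<in>B. (- c b / c x) * b)" by simp
    then show ?thesis using c(1)
      by (intro span_overI[of B "\<lambda>b. - c b / c x"]) (auto intro!: subfieldD(5)[OF F(1)] subfield_divide[OF F(1)])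
  qed
  moreover have "span_over F B \<subseteq> K"
    unfolding span_over_def using B(2) F by (auto intro!: subfield_sum[OF K] subfieldD[OF K])
  ultimately have "basis_over F K B" using B by (auto simp: basis_over_def)
  then have ex: "\<exists>B. basis_over F K B" by blast
  \<comment> \<open>The basis selected in \<open>ext_degree\<close> is itself finite and
    independent, so \<open>bnd\<close> applies to it directly.\<close>
  from someI_ex[OF ex] have "card (SOME B. basis_over F K B) \<le> m"
    by (auto simp: basis_over_def intro: bnd)
  then show ?thesis using ex by (auto simp: ext_degree_def)
qed

section \<open>Simple extensions of the rationals\<close>

text \<open>The target field is left open so that one rational polynomial can be evaluated both at a
  real generator and at its complex conjugates.\<close>

definition rat_eval :: "rat poly \<Rightarrow> 'a::field_char_0 \<Rightarrow> 'a" where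
  "rat_eval q x = poly (map_poly of_rat q) x"

lemma rat_eval_const: "rat_eval [:c:] x = of_rat c"
  by (simp add: rat_eval_def poly_altdef coeff_map_poly)

lemma rat_eval_simps:
  "rat_eval 0 x = 0" "rat_eval 1 x = 1" "rat_eval [:0, 1:] x = x"
  "rat_eval (p + q) x = rat_eval p x + rat_eval q x"
  "rat_eval (p - q) x = rat_eval p x - rat_eval q x"
  "rat_eval (- p) x = - rat_eval p x"
  "rat_eval (p * q) x = rat_eval p x * rat_eval q x"
  by (simp_all add: rat_eval_def map_poly_pCons of_rat_poly_hom.hom_add of_rat_poly_hom.hom_minus
      of_rat_poly_hom.hom_uminus of_rat_poly_hom.hom_mult)

lemma of_real_of_rat: "complex_of_real (of_rat r) = of_rat r"
  using hom_on_Rats[OF is_subfield_Rats, of complex_of_real r] by (auto simp: hom_on_def)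

lemma rat_eval_of_real: "rat_eval q (complex_of_real x) = of_real (rat_eval q x)"
  unfolding rat_eval_def
  by (induction q) (auto simp: map_poly_pCons of_real_of_rat)

lemma rat_eval_mod:
  assumes "rat_eval p x = 0"
  shows "rat_eval (q mod p) x = rat_eval q x"
proof -
  have "rat_eval q x = rat_eval (q div p * p + q mod p) x" by simp
  then show ?thesis using assms by (simp only: rat_eval_simps) simp
qed

definition simple_field :: "real \<Rightarrow> real set" where
  "simple_field w = range (\<lambda>q. rat_eval q w)"

text \<open>Take a nonzero annihilator of least degree: the remainder of any other annihilator has
  smaller degree and vanishes at \<open>w\<close> too, so it is zero.\<close>

lemma minimal_rat_poly:
  assumes "algebraic_int (w :: real)"
  obtains p where "p \<noteq> 0" "degree p > 0" "rat_eval p w = 0" "\<And>q. rat_eval q w = 0 \<Longrightarrow> p dvd q"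
    "\<And>q. rat_eval q w = 0 \<Longrightarrow> q \<noteq> 0 \<Longrightarrow> degree p \<le> degree q"
proof -
  obtain f :: "int poly" where f: "poly (map_poly of_int f) w = 0" "lead_coeff f = 1"
    using assms by (auto simp: algebraic_int_altdef_ipoly)
  define P where "P = (\<lambda>q. q \<noteq> 0 \<and> rat_eval q w = 0)"
  have "map_poly of_rat (map_poly of_int f :: rat poly) = (map_poly of_int f :: real poly)"
    by (simp add: map_poly_map_poly o_def)
  then have "P (map_poly of_int f)" using f by (auto simp: P_def rat_eval_def)
  then obtain p where p: "P p" "\<And>q. P q \<Longrightarrow> degree p \<le> degree q"
    using ex_has_least_nat[of P _ degree] by blast
  have "degree p > 0"
  proof (rule ccontr)
    assume "\<not> degree p > 0"
    then obtain c where "p = [:c:]" by (metis degree_eq_zeroE gr0I)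
    then show False using p(1) by (simp add: P_def rat_eval_const)
  qed
  moreover have "p dvd q" if "rat_eval q w = 0" for q
  proof (rule ccontr)
    assume "\<not> p dvd q"
    then have "q mod p \<noteq> 0" by (simp add: mod_eq_0_iff_dvd)
    moreover have "degree (q mod p) < degree p"
      using degree_mod_less'[of p q] p(1) calculation by (auto simp: P_def)
    moreover have "rat_eval (q mod p) w = 0" using rat_eval_mod[of p w q] that p(1) by (simp add: P_def)
    ultimately show False using p(2)[of "q mod p"] by (simp add: P_def)
  qed
  ultimately show ?thesis using p by (intro that[of p]) (auto simp: P_def)
qed

lemma is_subfield_simple_field:
  assumes "algebraic_int w"
  shows "is_subfield (simple_field w)"
proof -
  obtain p where p: "p \<noteq> 0" "degree p > 0" "rat_eval p w = 0"
    "\<And>q. rat_eval q w = 0 \<Longrightarrow> q \<noteq> 0 \<Longrightarrow> degree p \<le> degree q"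
    using minimal_rat_poly[OF assms] by metis
  have inv: "inverse (rat_eval q w) \<in> simple_field w" for q
  proof (cases "rat_eval q w = 0")
    case True
    then show ?thesis by (auto simp: simple_field_def rat_eval_simps intro!: range_eqI[of _ _ 0])
  next
    case False
    \<comment> \<open>Since \<open>g\<close> divides \<open>q\<close>, it does not vanish at
      \<open>w\<close>, hence the cofactor of \<open>g\<close> in \<open>p\<close> does. By
      minimality that cofactor has full degree, so \<open>g\<close> is constant and the Bezout
      identity inverts \<open>q\<close> at \<open>w\<close>.\<close>
    define g where "g = gcd p q"
    obtain a b where ab: "a * p + b * q = g" unfolding g_def by (metis bezout_coefficients_fst_snd)
    have gw: "rat_eval g w = rat_eval b w * rat_eval q w"
      using p(3) by (simp flip: ab add: rat_eval_simps)
    obtain h where h: "p = g * h" unfolding g_def by (meson dvdE gcd_dvd1)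
    obtain h' where h': "q = g * h'" unfolding g_def by (meson dvdE gcd_dvd2)
    have g0: "rat_eval g w \<noteq> 0" using False by (auto simp: h' rat_eval_simps)
    then have "rat_eval h w = 0" using p(3) by (simp add: h rat_eval_simps)
    moreover have "h \<noteq> 0" "g \<noteq> 0" using p(1) h by auto
    ultimately have "degree g = 0" using p(4)[of h] by (auto simp: h degree_mult_eq)
    then obtain c where c: "g = [:c:]" by (metis degree_eq_zeroE)
    have "inverse (rat_eval q w) = rat_eval b w * inverse (of_rat c)"
      using gw g0 False by (simp add: c rat_eval_const field_simps)
    also have "\<dots> = rat_eval (b * [:inverse c:]) w"
      by (simp only: rat_eval_simps rat_eval_const of_rat_inverse)
    finally have "inverse (rat_eval q w) = rat_eval (b * [:inverse c:]) w" .
    then show ?thesis unfolding simple_field_def by (rule range_eqI)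
  qed
  show ?thesis unfolding is_subfield_def
  proof (intro conjI ballI)
    show "0 \<in> simple_field w" "1 \<in> simple_field w"
      unfolding simple_field_def by (auto simp: image_iff intro: exI[of _ 0] exI[of _ 1] simp: rat_eval_simps)
    fix x y assume "x \<in> simple_field w" "y \<in> simple_field w"
    then obtain f g where fg: "x = rat_eval f w" "y = rat_eval g w" by (auto simp: simple_field_def)
    show "x + y \<in> simple_field w" "- x \<in> simple_field w" "x * y \<in> simple_field w" "inverse x \<in> simple_field w"
      using inv[of f] unfolding fg by (auto simp: simple_field_def rat_eval_simps(4-7)[symmetric])
  qed
qed

lemma mem_simple_field: "w \<in> simple_field w"
  unfolding simple_field_def by (rule range_eqI[of _ _ "[:0, 1:]"]) (simp add: rat_eval_simps)

lemma simple_field_least: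
  assumes "is_subfield F" "w \<in> F"
  shows "simple_field w \<subseteq> F"
proof -
  have "rat_eval q w \<in> F" for q
    unfolding rat_eval_def
    by (induction q) (use assms subfield_Rats[OF assms(1)] in \<open>auto simp: map_poly_pCons intro!: subfieldD\<close>)
  then show ?thesis by (auto simp: simple_field_def)
qed

text \<open>Embeddings correspond to the roots of the minimal polynomial \<open>p\<close>, the
  identity to \<open>w\<close> itself. The norm of \<open>rat_eval q w\<close> is the product of
  \<open>q\<close> over these roots, rational by \<open>prod_roots_rat_poly_in_Rats\<close>.\<close>

lemma norm_family_simple_field:
  assumes w: "algebraic_int w"
  shows "\<exists>\<Phi>. norm_family (simple_field w) \<Phi>"
proof -
  obtain p where p: "p \<noteq> 0" "degree p > 0" "rat_eval p w = 0" "\<And>q. rat_eval q w = 0 \<Longrightarrow> p dvd q"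
    "\<And>q. rat_eval q w = 0 \<Longrightarrow> q \<noteq> 0 \<Longrightarrow> degree p \<le> degree q"
    using minimal_rat_poly[OF w] by metis
  define l where "l = (lead_coeff (map_poly of_rat p) :: complex)"
  obtain as where as: "map_poly of_rat p = Polynomial.smult l (\<Prod>a\<leftarrow>as. [:- a, 1:])"
    "length as = degree (map_poly of_rat p :: complex poly)"
    using fundamental_theorem_algebra_factorized[of "map_poly of_rat p"] unfolding l_def by metis
  have l0: "l \<noteq> 0" using p(1) by (auto simp: l_def)
  have len: "length as = degree p" using as(2) by simp
  have root_iff: "rat_eval p a = 0 \<longleftrightarrow> a \<in> set as" for a :: complex
    using l0 by (auto simp: rat_eval_def as(1) poly_prod_list prod_list_zero_iff)
  let ?w = "complex_of_real w"
  have w_mem: "?w \<in> set as" using root_iff[of ?w] p(3) by (simp add: rat_eval_of_real)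
  define bs where "bs = remove1 ?w as"
  have prod_bs: "(\<Prod>a\<leftarrow>as. f a) = f ?w * (\<Prod>a\<leftarrow>bs. f a)" for f :: "complex \<Rightarrow> 'b::comm_monoid_mult"
    unfolding bs_def using prod_list_map_remove1[OF w_mem, of f] by simp
  have set_bs: "set bs \<subseteq> set as" unfolding bs_def by (rule set_remove1_subset)
  \<comment> \<open>Minimality of \<open>p\<close> makes \<open>w\<close> a simple root.\<close>
  have w_notin: "?w \<notin> set bs"
  proof
    assume "?w \<in> set bs"
    define g where "g = (\<Prod>a\<leftarrow>bs. [:- a, 1:])"
    have "poly g ?w = 0" using \<open>?w \<in> set bs\<close> by (auto simp: g_def poly_prod_list prod_list_zero_iff)
    moreover have "map_poly of_rat p = Polynomial.smult l ([:- ?w, 1:] * g)"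
      unfolding as(1) g_def using prod_bs[of "\<lambda>a. [:- a, 1:]"] by simp
    ultimately have "poly (pderiv (map_poly of_rat p)) ?w = 0"
      by (simp add: pderiv_smult pderiv_mult pderiv_pCons del: mult_pCons_left)
    moreover have "pderiv (map_poly of_rat p :: complex poly) = map_poly of_rat (pderiv p)"
      by (simp add: poly_eq_iff coeff_pderiv coeff_map_poly of_rat_mult of_rat_add)
    ultimately have "rat_eval (pderiv p) ?w = 0" by (simp add: rat_eval_def)
    then have "rat_eval (pderiv p) w = 0" by (simp add: rat_eval_of_real)
    moreover have "pderiv p \<noteq> 0" using p(2) by (simp add: pderiv_eq_0_iff)
    ultimately show False using p(5)[of "pderiv p"] p(2) by (simp add: degree_pderiv)
  qed
  \<comment> \<open>The embedding with \<open>w\<close> sent to \<open>a\<close>. Two polynomials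
    representing the same element differ by a multiple of \<open>p\<close>, which vanishes at
    \<open>a\<close>, so the choice is harmless.\<close>
  define emb where "emb = (\<lambda>a::complex. \<lambda>x. rat_eval (SOME q. rat_eval q w = x) a)"
  have emb: "emb a (rat_eval q w) = rat_eval q a" if a: "a \<in> set as" for a q
  proof -
    define f where "f = (SOME f. rat_eval f w = rat_eval q w)"
    have "rat_eval f w = rat_eval q w" unfolding f_def by (rule someI) (rule refl)
    then have "p dvd f - q" by (intro p(4)) (simp add: rat_eval_simps)
    then obtain g where "f - q = p * g" by (rule dvdE)
    then have "rat_eval (f - q) a = rat_eval p a * rat_eval g a" by (simp add: rat_eval_simps)
    then show ?thesis using a root_iff[of a] by (simp add: emb_def f_def rat_eval_simps)
  qed
  define \<Phi> where "\<Phi> = map emb bs"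
  have hom: "hom_on (simple_field w) (emb a)" if a: "a \<in> set as" for a
  proof -
    have "emb a 1 = 1" using emb[OF a, of 1] by (simp add: rat_eval_simps)
    moreover have "emb a (rat_eval f w + rat_eval g w) = emb a (rat_eval f w) + emb a (rat_eval g w)"
      "emb a (rat_eval f w * rat_eval g w) = emb a (rat_eval f w) * emb a (rat_eval g w)" for f g
      using emb[OF a, of "f + g"] emb[OF a, of "f * g"] by (simp_all add: emb[OF a] rat_eval_simps)
    ultimately show ?thesis by (auto simp: hom_on_def simple_field_def)
  qed
  have "emb a w \<noteq> of_real w" if "a \<in> set bs" for a
    using emb[of a "[:0, 1:]"] that set_bs w_notin by (auto simp: rat_eval_simps)
  then have 1: "\<forall>\<phi>\<in>set \<Phi>. hom_on (simple_field w) \<phi> \<and> (\<exists>x\<in>simple_field w. \<phi> x \<noteq> of_real x)"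
    using hom set_bs mem_simple_field[of w] unfolding \<Phi>_def by fastforce
  have 2: "of_real x * (\<Prod>\<phi>\<leftarrow>\<Phi>. \<phi> x) \<in> \<rat>" if x: "x \<in> simple_field w" for x
  proof -
    obtain q where q: "x = rat_eval q w" using x by (auto simp: simple_field_def)
    have "(\<Prod>\<phi>\<leftarrow>\<Phi>. \<phi> x) = (\<Prod>a\<leftarrow>bs. rat_eval q a)"
      unfolding \<Phi>_def q by (intro arg_cong[of _ _ prod_list]) (simp add: emb subsetD[OF set_bs])
    then have "of_real x * (\<Prod>\<phi>\<leftarrow>\<Phi>. \<phi> x) = (\<Prod>a\<leftarrow>as. rat_eval q a)"
      using prod_bs[of "rat_eval q"] by (simp add: q rat_eval_of_real)
    also have "\<dots> \<in> \<rat>" unfolding rat_eval_def by (rule prod_roots_rat_poly_in_Rats[OF p(1) as(1)])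
    finally show ?thesis .
  qed
  define S where "S = (\<lambda>i. w ^ i) ` {..<degree p}"
  have "card S \<le> degree p" unfolding S_def using card_image_le[of "{..<degree p}"] by simp
  moreover have "Suc (length \<Phi>) = degree p"
    using w_mem len p(2) by (simp add: \<Phi>_def bs_def length_remove1)
  moreover have "x \<in> rat_real.span S" if x: "x \<in> simple_field w" for x
  proof -
    obtain q where q: "x = rat_eval q w" using x by (auto simp: simple_field_def)
    define r where "r = q mod p"
    have "x = rat_eval r w" using rat_eval_mod[OF p(3), of q] by (simp add: q r_def)
    also have "\<dots> = (\<Sum>i\<le>degree r. of_rat (coeff r i) * w ^ i)"
      by (simp add: rat_eval_def poly_altdef coeff_map_poly)
    also have "\<dots> \<in> rat_real.span S"
    proof (intro rat_real.span_sum rat_real.span_scale rat_real.span_base)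
      fix i assume "i \<in> {..degree r}"
      moreover have "degree r < degree p" using degree_mod_less[of p q] p by (auto simp: r_def)
      ultimately show "w ^ i \<in> S" by (auto simp: S_def)
    qed
    finally show ?thesis .
  qed
  ultimately have "\<exists>S. finite S \<and> card S \<le> Suc (length \<Phi>) \<and> simple_field w \<subseteq> rat_real.span S"
    by (intro exI[of _ S]) (auto simp: S_def)
  then show ?thesis using 1 2 is_subfield_simple_field[OF w] unfolding norm_family_def by blast
qed

text \<open>Whether the square root already lies in the simple field is left undecided: either
  nothing is added, or the quadratic step applies.\<close>

lemma norm_family_adjoin_sqrt:
  assumes w: "algebraic_int w" and d: "0 \<le> d" "d \<in> \<rat>"
  shows "\<exists>\<Phi>. norm_family (adjoin (simple_field w) (sqrt d)) \<Phi>"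
proof (cases "sqrt d \<in> simple_field w")
  case True
  note F = is_subfield_simple_field[OF w]
  have "adjoin (simple_field w) (sqrt d) = simple_field w"
    using adjoin_least[OF F order_refl True] subset_adjoin[OF F] by blast
  then show ?thesis using norm_family_simple_field[OF w] by simp
next
  case False
  then show ?thesis using norm_family_simple_field[OF w] norm_family_adjoin d by fastforce
qed

section \<open>Bounds for the auxiliary functions\<close>

text \<open>Weighted AM-GM, from \<open>t \<le> exp (t - 1)\<close>. It is applied to factors
  divided by their sizes at an extremal point. At an interior critical point the logarithmic
  derivative vanishes, so the weighted sum, linear on each sign piece, is constant there and the
  estimate is sharp.\<close>

lemma weighted_product_le_1:
  fixes x y z :: real
  assumes "0 \<le> x" "0 \<le> y" "0 \<le> z"
    and le: "real i * x + real j * y + real k * z \<le> real i + real j + real k"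
  shows "x ^ i * y ^ j * z ^ k \<le> 1"
proof -
  have pw: "t ^ n \<le> exp (real n * (t - 1))" if "0 \<le> t" for t :: real and n
    using power_mono[of t "exp (t - 1)" n] exp_ge_add_one_self[of "t - 1"] that
    by (simp add: exp_of_nat_mult)
  have "x ^ i * y ^ j * z ^ k \<le> exp (real i * (x - 1)) * exp (real j * (y - 1)) * exp (real k * (z - 1))"
    using assms by (intro mult_mono pw) auto
  also have "\<dots> = exp (real i * (x - 1) + real j * (y - 1) + real k * (z - 1))"
    by (simp add: exp_add)
  also have "\<dots> \<le> 1" using le by (simp add: algebra_simps)
  finally show ?thesis .
qed

text \<open>The weights are the reciprocal sizes of the factors at the extremal points of the three
  pieces: the end point -1/4 and the critical points 1/2 and 8/5. The last gives the maximum, just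
  below 0.091.\<close>

lemma aux_bound_3_3:
  fixes q :: real
  assumes "- 1 / 4 \<le> q" "q \<le> 2"
  shows "\<bar>q ^ 4 * (q - 1) ^ 3 * (q - 2) ^ 3\<bar> \<le> 92 / 1000"
proof -
  consider "q \<le> 0" | "0 \<le> q" "q \<le> 1" | "1 \<le> q" by linarith
  then have "\<bar>q\<bar> ^ 4 * \<bar>q - 1\<bar> ^ 3 * \<bar>q - 2\<bar> ^ 3 \<le> 92 / 1000"
  proof cases
    case 1
    have "4 * (4 * \<bar>q\<bar>) + 3 * (4/5 * \<bar>q - 1\<bar>) + 3 * (4/9 * \<bar>q - 2\<bar>) \<le> 10" using 1 assms by argo
    then show ?thesis using weighted_product_le_1[of "4 * \<bar>q\<bar>" "4/5 * \<bar>q - 1\<bar>" "4/9 * \<bar>q - 2\<bar>" 4 3 3]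
      by (simp add: power_mult_distrib power_divide)
  next
    case 2
    have "4 * (2 * \<bar>q\<bar>) + 3 * (2 * \<bar>q - 1\<bar>) + 3 * (2/3 * \<bar>q - 2\<bar>) \<le> 10" using 2 by argo
    then show ?thesis using weighted_product_le_1[of "2 * \<bar>q\<bar>" "2 * \<bar>q - 1\<bar>" "2/3 * \<bar>q - 2\<bar>" 4 3 3]
      by (simp add: power_mult_distrib power_divide)
  next
    case 3
    have "4 * (5/8 * \<bar>q\<bar>) + 3 * (5/3 * \<bar>q - 1\<bar>) + 3 * (5/2 * \<bar>q - 2\<bar>) \<le> 10" using 3 assms by argo
    then show ?thesis using weighted_product_le_1[of "5/8 * \<bar>q\<bar>" "5/3 * \<bar>q - 1\<bar>" "5/2 * \<bar>q - 2\<bar>" 4 3 3]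
      by (simp add: power_mult_distrib power_divide)
  qed
  then show ?thesis by (simp add: abs_mult power_abs)
qed

text \<open>The extremal points are -1/2 and 4/5; the value 3/32 is attained at the former.\<close>

lemma aux_bound_3_4:
  fixes q :: real
  assumes "- 1 / 2 \<le> q" "q \<le> 1"
  shows "\<bar>q ^ 4 * (q - 1)\<bar> \<le> 3 / 32"
proof -
  have "\<bar>q\<bar> ^ 4 * \<bar>q - 1\<bar> \<le> 3 / 32"
  proof (cases "q \<le> 0")
    case True
    have "4 * (2 * \<bar>q\<bar>) + 2/3 * \<bar>q - 1\<bar> \<le> 5" using True assms by argo
    then show ?thesis using weighted_product_le_1[of "2 * \<bar>q\<bar>" "2/3 * \<bar>q - 1\<bar>" 1 4 1 0]
      by (simp add: power_mult_distrib power_divide)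
  next
    case False
    have "4 * (5/4 * \<bar>q\<bar>) + 5 * \<bar>q - 1\<bar> \<le> 5" using False assms by argo
    then show ?thesis using weighted_product_le_1[of "5/4 * \<bar>q\<bar>" "5 * \<bar>q - 1\<bar>" 1 4 1 0]
      by (simp add: power_mult_distrib power_divide)
  qed
  then show ?thesis by (simp add: abs_mult power_abs)
qed

lemma aux_bound_4_4:
  fixes q :: real
  assumes "- 1 \<le> q" "q \<le> 0"
  shows "\<bar>q * (q + 1)\<bar> \<le> 1 / 4"
proof -
  have "\<bar>q * (q + 1)\<bar> = - q * (q + 1)" using assms by (simp add: abs_mult)
  also have "\<dots> = 1 / 4 - (q + 1 / 2)\<^sup>2" by (simp add: power2_eq_square algebra_simps)
  finally show ?thesis by simp
qed

text \<open>An embedding may send \<open>b\<close> to either root; with these decimal enclosures the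
  later estimates become linear arithmetic.\<close>

lemma golden_cases:
  fixes b :: real
  assumes "b\<^sup>2 = b + 1"
  obtains "1618 / 1000 < b" "b < 16181 / 10000" | "- 6181 / 10000 < b" "b < - 618 / 1000"
proof -
  have "(2 * b - 1)\<^sup>2 = 5" using assms by (simp add: power2_eq_square algebra_simps)
  then have "\<bar>2 * b - 1\<bar> = sqrt 5" by (metis real_sqrt_abs)
  moreover have "2236 / 1000 < sqrt 5" "sqrt 5 < 22362 / 10000"
    by (rule real_less_rsqrt real_less_lsqrt; simp add: power2_eq_square)+
  ultimately show ?thesis using that by linarith
qed

lemma golden_powers:
  fixes b :: real
  assumes "b\<^sup>2 = b + 1"
  shows "b ^ 3 = 2 * b + 1" "b ^ 4 = 3 * b + 2"
  using assms by (simp_all add: power2_eq_square power3_eq_cube power4_eq_xxxx algebra_simps)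

text \<open>\<open>A\<close>, \<open>B\<close>, \<open>C\<close> will be reciprocals of approximate
  factor sizes near an extremal point of each sign piece, and the last premise compares their
  product with the target \<open>c\<close>.\<close>

lemma abs_product3_le:
  fixes x y z A B C :: real
  assumes "0 < A" "0 < B" "0 < C" "A * \<bar>x\<bar> + B * \<bar>y\<bar> + C * \<bar>z\<bar> \<le> 3" "1 \<le> c * (A * B * C)"
  shows "\<bar>x\<bar> * \<bar>y\<bar> * \<bar>z\<bar> \<le> c"
proof -
  have "(A * B * C) * (\<bar>x\<bar> * \<bar>y\<bar> * \<bar>z\<bar>) \<le> 1"
    using weighted_product_le_1[of "A * \<bar>x\<bar>" "B * \<bar>y\<bar>" "C * \<bar>z\<bar>" 1 1 1] assms
    by (simp add: mult_ac)
  also have "\<dots> \<le> (A * B * C) * c" using assms(5) by (simp add: mult.commute)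
  finally show ?thesis using assms by simp
qed

text \<open>For the two values of \<open>b\<close> the interval is about [-0.655, 0.382] or
  [-0.096, 2.618], and both times it contains the roots 1 - b, 0 and 2 - b. The factor
  \<open>b ^ 3\<close>, of size 4.236 or 0.236, balances the bounds 0.071 and 1.27 to about
  0.30.\<close>

lemma aux_bound_3_5:
  fixes q b :: real
  assumes b: "b\<^sup>2 = b + 1" and q: "- (b + 1) / 4 \<le> q" "q \<le> 2 - b"
  shows "\<bar>b ^ 3 * ((q + b - 1) * q * (q + b - 2))\<bar> \<le> 305 / 1000"
  using b
proof (cases rule: golden_cases)
  case 1
  have "\<bar>q + b - 1\<bar> * \<bar>q\<bar> * \<bar>q + b - 2\<bar> \<le> 71 / 1000"
  proof -
    consider "q + b - 1 \<le> 0" | "q + b - 1 \<ge> 0" "q \<le> 0" | "0 \<le> q" by linarith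
    then show ?thesis
    proof cases
      case 1
      show ?thesis by (rule abs_product3_le[of "1000/38" "1000/657" "1000/1041"]) (use 1 q \<open>1618 / 1000 < b\<close> \<open>b < 16181 / 10000\<close> in argo)+
    next
      case 2
      show ?thesis by (rule abs_product3_le[of "1000/249" "1000/372" "1000/755"]) (use 2 q \<open>1618 / 1000 < b\<close> \<open>b < 16181 / 10000\<close> in argo)+
    next
      case 3
      show ?thesis by (rule abs_product3_le[of "1000/834" "1000/214" "1000/170"]) (use 3 q \<open>1618 / 1000 < b\<close> \<open>b < 16181 / 10000\<close> in argo)+
    qed
  qed
  then have "\<bar>b ^ 3\<bar> * (\<bar>q + b - 1\<bar> * \<bar>q\<bar> * \<bar>q + b - 2\<bar>) \<le> 42363 / 10000 * (71 / 1000)"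
    using 1 by (intro mult_mono) (auto simp: golden_powers[OF b])
  then show ?thesis by (simp add: abs_mult)
next
  case 2
  have "\<bar>q + b - 1\<bar> * \<bar>q\<bar> * \<bar>q + b - 2\<bar> \<le> 127 / 100"
  proof -
    consider "q \<le> 0" | "0 \<le> q" "q + b - 1 \<le> 0" | "0 \<le> q + b - 1" by linarith
    then show ?thesis
    proof cases
      case 1
      show ?thesis by (rule abs_product3_le[of "100/172" "1000/96" "1000/2724"]) (use 1 q \<open>- 6181 / 10000 < b\<close> \<open>b < - 618 / 1000\<close> in argo)+
    next
      case 2
      show ?thesis by (rule abs_product3_le[of "1000/973" "1000/652" "1000/1977"]) (use 2 q \<open>- 6181 / 10000 < b\<close> \<open>b < - 618 / 1000\<close> in argo)+
    next
      case 3
      show ?thesis by (rule abs_product3_le[of "1000/559" "1000/2183" "1000/445"]) (use 3 q \<open>- 6181 / 10000 < b\<close> \<open>b < - 618 / 1000\<close> in argo)+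
    qed
  qed
  then have "\<bar>b ^ 3\<bar> * (\<bar>q + b - 1\<bar> * \<bar>q\<bar> * \<bar>q + b - 2\<bar>) \<le> 2362 / 10000 * (127 / 100)"
    using 2 by (intro mult_mono) (auto simp: golden_powers[OF b])
  then show ?thesis by (simp add: abs_mult)
qed

text \<open>Replacing \<open>q\<close> by \<open>- q\<close> turns the product for one root
  \<open>b\<close> into the product for the other, up to sign. The two conjugates are therefore
  balanced without a power of \<open>b\<close>.\<close>

lemma aux_bound_4_5:
  fixes q b :: real
  assumes b: "b\<^sup>2 = b + 1" and q: "- (b + 1) / 2 \<le> q" "q \<le> 1 - b"
  shows "\<bar>q * (q + b) * (q + b - 1)\<bar> \<le> 4 / 10"
  using b
proof (cases rule: golden_cases)
  case 1
  have "\<bar>q\<bar> * \<bar>q + b\<bar> * \<bar>q + b - 1\<bar> \<le> 4 / 10"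
    by (rule abs_product3_le[of "1000/1222" "1000/403" "1000/601"]) (use q 1 in argo)+
  then show ?thesis by (simp add: abs_mult)
next
  case 2
  consider "q \<le> 0" | "0 \<le> q" "q + b \<le> 0" | "0 \<le> q + b" by linarith
  then have "\<bar>q\<bar> * \<bar>q + b\<bar> * \<bar>q + b - 1\<bar> \<le> 4 / 10"
  proof cases
    case 1
    show ?thesis by (rule abs_product3_le[of "1000/192" "1000/812" "1000/1816"]) (use 1 q \<open>- 6181 / 10000 < b\<close> \<open>b < - 618 / 1000\<close> in argo)+
  next
    case 2
    show ?thesis by (rule abs_product3_le[of "1000/275" "1000/345" "1000/1349"]) (use 2 q \<open>- 6181 / 10000 < b\<close> \<open>b < - 618 / 1000\<close> in argo)+
  next
    case 3
    show ?thesis by (rule abs_product3_le[of "1000/1222" "1000/601" "1000/403"]) (use 3 q \<open>- 6181 / 10000 < b\<close> \<open>b < - 618 / 1000\<close> in argo)+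
  qed
  then show ?thesis by (simp add: abs_mult)
qed

text \<open>The roots are \<open>- b\<close> and the right end point \<open>2 - 2 * b\<close>. The
  factor \<open>b ^ 4\<close>, of size 6.854 or 0.146, balances the bounds 0.047 and 2.2. The third
  factor 1 only pads the product to three.\<close>

lemma aux_bound_5_5:
  fixes q b :: real
  assumes b: "b\<^sup>2 = b + 1" and q: "- (b ^ 4) / 4 \<le> q" "q \<le> 2 - 2 * b"
  shows "\<bar>b ^ 4 * ((q + b) * (q + 2 * b - 2))\<bar> \<le> 33 / 100"
  using b
proof (cases rule: golden_cases)
  case 1
  have "\<bar>q + b\<bar> * \<bar>q + 2 * b - 2\<bar> * \<bar>1\<bar> \<le> 47 / 1000"
  proof (cases "q + b \<le> 0")
    case True
    show ?thesis by (rule abs_product3_le[of "1000/97" "1000/479" "1"]) (use True q 1 golden_powers[OF b] in argo)+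
  next
    case False
    show ?thesis by (rule abs_product3_le[of "1000/192" "1000/192" "1"]) (use False q 1 in argo)+
  qed
  then have "\<bar>b ^ 4\<bar> * (\<bar>q + b\<bar> * \<bar>q + 2 * b - 2\<bar>) \<le> 68544 / 10000 * (47 / 1000)"
    using 1 by (intro mult_mono) (auto simp: golden_powers[OF b])
  then show ?thesis by (simp add: abs_mult)
next
  case 2
  have "\<bar>q + b\<bar> * \<bar>q + 2 * b - 2\<bar> * \<bar>1\<bar> \<le> 22 / 10"
  proof (cases "q + b \<le> 0")
    case True
    show ?thesis by (rule abs_product3_le[of "100/66" "10/33" "1"]) (use True q 2 golden_powers[OF b] in argo)+
  next
    case False
    show ?thesis by (rule abs_product3_le[of "1000/1314" "1000/1314" "1"]) (use False q 2 in argo)+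
  qed
  then have "\<bar>b ^ 4\<bar> * (\<bar>q + b\<bar> * \<bar>q + 2 * b - 2\<bar>) \<le> 146 / 1000 * (22 / 10)"
    using 2 by (intro mult_mono) (auto simp: golden_powers[OF b])
  then show ?thesis by (simp add: abs_mult)
qed

text \<open>For the angle \<open>pi / 5\<close> the cosines of its triple and its double are
  opposite. The resulting cubic in the cosine has the factor \<open>x + 1\<close>, excluded by
  positivity.\<close>

lemma two_cos_pi_5:
  defines "b \<equiv> 2 * cos (pi / 5)"
  shows "b\<^sup>2 = b + 1" "b > 0" "sqrt 5 = 2 * b - 1"
proof -
  define x where "x = cos (pi / 5)"
  have x0: "x > 0" unfolding x_def by (rule cos_gt_zero) (auto simp: field_simps)
  have "3 * (pi / 5) = pi - 2 * (pi / 5)" by simp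
  then have "cos (3 * (pi / 5)) = cos (pi - 2 * (pi / 5))" by (simp only:)
  also have "\<dots> = - cos (2 * (pi / 5))" by (rule cos_pi_minus)
  finally have "4 * x ^ 3 - 3 * x = - (2 * x\<^sup>2 - 1)"
    unfolding cos_treble_cos cos_double_cos x_def by simp
  then have "(x + 1) * (4 * x\<^sup>2 - 2 * x - 1) = 0"
    by (simp add: power2_eq_square power3_eq_cube algebra_simps)
  then have "4 * x\<^sup>2 = 2 * x + 1" using x0 by auto
  then show eq: "b\<^sup>2 = b + 1" by (simp add: b_def x_def power_mult_distrib)
  show b0: "b > 0" using x0 by (simp add: b_def x_def)
  have "b > 1" using eq b0 by (smt (verit) power2_eq_square mult_left_le)
  moreover have "(2 * b - 1)\<^sup>2 = 5" using eq by (simp add: power2_eq_square algebra_simps)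
  ultimately show "sqrt 5 = 2 * b - 1" by (intro real_sqrt_unique) auto
qed

section \<open>The ground field\<close>

lemma tri_matrix_simps:
  "dim_row (tri_matrix u s k) = 3" "dim_col (tri_matrix u s k) = 3"
  "tri_matrix u s k $$ (0, 0) = -2" "tri_matrix u s k $$ (0, Suc 0) = u"
  "tri_matrix u s k $$ (0, 2) = 2 * cos (pi / real s)"
  "tri_matrix u s k $$ (Suc 0, 0) = u" "tri_matrix u s k $$ (Suc 0, Suc 0) = -2"
  "tri_matrix u s k $$ (Suc 0, 2) = 2 * cos (pi / real k)"
  "tri_matrix u s k $$ (2, 0) = 2 * cos (pi / real s)"
  "tri_matrix u s k $$ (2, Suc 0) = 2 * cos (pi / real k)" "tri_matrix u s k $$ (2, 2) = -2"
  by (auto simp: tri_matrix_def mat_of_rows_list_def)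

lemma less_3_cases: "i < 3 \<Longrightarrow> i = 0 \<or> i = Suc 0 \<or> i = (2::nat)"
  by linarith

lemma prod_cyclic_shift:
  fixes f :: "nat \<Rightarrow> 'a::comm_monoid_mult"
  shows "(\<Prod>j<n. f ((j + 1) mod n)) = (\<Prod>j<n. f j)"
proof (cases n)
  case (Suc m)
  have "(\<Prod>j<n. f ((j + 1) mod n)) = (\<Prod>j<m. f (Suc j)) * f 0"
    unfolding Suc by (simp add: mod_Suc)
  then show ?thesis unfolding Suc prod.lessThan_Suc_shift by (simp add: mult.commute)
qed simp

text \<open>Conjugation by a diagonal matrix does not change the cyclic products.\<close>

lemma cyclic_products_subset:
  assumes F: "is_subfield F" and d: "\<And>i. d i \<noteq> 0"
    and mem: "\<And>i j. i < dim_row A \<Longrightarrow> j < dim_row A \<Longrightarrow> d i * A $$ (i, j) / d j \<in> F"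
  shows "cyclic_products A \<subseteq> F"
proof
  fix x assume "x \<in> cyclic_products A"
  then obtain xs where x: "x = (\<Prod>j<length xs. A $$ (xs ! j, xs ! ((j + 1) mod length xs)))"
    and xs: "xs \<noteq> []" "set xs \<subseteq> {..<dim_row A}"
    unfolding cyclic_products_def by blast
  let ?n = "length xs"
  have "(\<Prod>j<?n. d (xs ! j) * A $$ (xs ! j, xs ! ((j + 1) mod ?n)) / d (xs ! ((j + 1) mod ?n))) =
      (\<Prod>j<?n. d (xs ! j)) * x / (\<Prod>j<?n. d (xs ! ((j + 1) mod ?n)))"
    by (simp only: x prod_dividef prod.distrib)
  also have "(\<Prod>j<?n. d (xs ! ((j + 1) mod ?n))) = (\<Prod>j<?n. d (xs ! j))"
    by (rule prod_cyclic_shift)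
  also have "(\<Prod>j<?n. d (xs ! j)) * x / (\<Prod>j<?n. d (xs ! j)) = x" using d by simp
  finally have eq: "x = (\<Prod>j<?n. d (xs ! j) * A $$ (xs ! j, xs ! ((j + 1) mod ?n)) / d (xs ! ((j + 1) mod ?n)))"
    by (rule sym)
  have "xs ! j < dim_row A" if "j < ?n" for j using xs that nth_mem by blast
  then show "x \<in> F" using xs(1) unfolding eq by (intro subfield_prod[OF F] mem) auto
qed

context
  fixes u :: real and s k :: nat and a b :: real and A :: "real mat" and K L :: "real set"
  defines "a \<equiv> 2 * cos (pi / real s)" and "b \<equiv> 2 * cos (pi / real k)"
    and "A \<equiv> tri_matrix u s k" and "K \<equiv> ground_field A" and "L \<equiv> entry_field A"
begin

lemma entries_in_entry_field: "u \<in> L" "a \<in> L" "b \<in> L"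
proof -
  have "A $$ (i, j) \<in> L" if "i < 3" "j < 3" for i j
    unfolding L_def entry_field_def using that
    by (intro gen_field_base) (auto simp: A_def tri_matrix_simps)
  from this[of 0 "Suc 0"] this[of 0 2] this[of "Suc 0" 2] show "u \<in> L" "a \<in> L" "b \<in> L"
    by (auto simp: A_def tri_matrix_simps a_def b_def)
qed

lemma is_subfield_ground_field: "is_subfield K" and is_subfield_entry_field: "is_subfield L"
  by (simp_all add: K_def L_def ground_field_def entry_field_def is_subfield_gen_field)

lemma entry_field_least:
  assumes F: "is_subfield F" and "u \<in> F" "a \<in> F" "b \<in> F"
  shows "L \<subseteq> F"
  unfolding L_def entry_field_def
proof (rule gen_field_least[OF F], safe)
  fix i j assume "i < dim_row A" "j < dim_row A"
  then show "A $$ (i, j) \<in> F"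
    using assms(2-4) subfieldD(5)[OF F subfield_numeral[OF F, of "num.Bit0 num.One"]] unfolding A_def tri_matrix_simps
    by (auto dest!: less_3_cases simp: tri_matrix_simps a_def b_def)
qed

lemma ground_field_subset_entry_field: "K \<subseteq> L"
  unfolding K_def ground_field_def
proof (rule gen_field_least[OF is_subfield_entry_field])
  show "cyclic_products A \<subseteq> L"
    by (rule cyclic_products_subset[OF is_subfield_entry_field, of "\<lambda>_. 1"])
       (auto simp: L_def entry_field_def intro!: gen_field_base)
qed

lemma cyclic_products_in_ground_field:
  "u\<^sup>2 \<in> K" "a\<^sup>2 \<in> K" "b\<^sup>2 \<in> K" "u * a * b \<in> K"
proof -
  have cyc: "(\<Prod>j<length xs. A $$ (xs ! j, xs ! ((j + 1) mod length xs))) \<in> K"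
    if "xs \<noteq> []" "set xs \<subseteq> {..<3}" for xs
    unfolding K_def ground_field_def cyclic_products_def using that
    by (intro gen_field_base) (auto simp: A_def tri_matrix_simps)
  show "u\<^sup>2 \<in> K" using cyc[of "[0, Suc 0]"]
    by (simp add: A_def tri_matrix_simps power2_eq_square lessThan_Suc)
  show "a\<^sup>2 \<in> K" using cyc[of "[0, 2]"]
    by (simp add: A_def tri_matrix_simps power2_eq_square lessThan_Suc a_def)
  show "b\<^sup>2 \<in> K" using cyc[of "[Suc 0, 2]"]
    by (simp add: A_def tri_matrix_simps power2_eq_square lessThan_Suc b_def)
  show "u * a * b \<in> K" using cyc[of "[0, Suc 0, 2]"]
    by (simp add: A_def tri_matrix_simps lessThan_Suc a_def b_def mult_ac)
qed

text \<open>The six memberships concern the off-diagonal entries of the conjugate of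
  \<open>A\<close> by the diagonal matrix of \<open>d0\<close>, \<open>d1\<close>,
  \<open>d2\<close>. They can lie in \<open>F\<close> when \<open>u\<close>, \<open>a\<close>,
  \<open>b\<close> do not, and cyclic products do not see the conjugation.\<close>

lemma ground_field_eqI:
  assumes F: "is_subfield F" and sub: "F \<subseteq> K"
    and d: "d0 \<noteq> 0" "d1 \<noteq> 0" "d2 \<noteq> 0"
    and mem: "d0 * u / d1 \<in> F" "d1 * u / d0 \<in> F" "d0 * a / d2 \<in> F" "d2 * a / d0 \<in> F"
      "d1 * b / d2 \<in> F" "d2 * b / d1 \<in> F"
  shows "K = F"
proof
  have two: "-2 \<in> F" using subfieldD(5)[OF F subfield_numeral[OF F]] .
  define d where "d = (\<lambda>i::nat. if i = 0 then d0 else if i = Suc 0 then d1 else d2)"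
  have "cyclic_products A \<subseteq> F"
  proof (rule cyclic_products_subset[OF F])
    show "d i \<noteq> 0" for i using assms(3-5) by (simp add: d_def)
    fix i j assume "i < dim_row A" "j < dim_row A"
    then show "d i * A $$ (i, j) / d j \<in> F"
      using mem two assms(3-5) unfolding A_def tri_matrix_simps
      by (auto dest!: less_3_cases simp: tri_matrix_simps d_def a_def b_def)
  qed
  then show "K \<subseteq> F" unfolding K_def ground_field_def by (rule gen_field_least[OF F])
qed (rule sub)

lemma neg_definite_tri_matrix:
  assumes nd: "neg_definite (map_mat \<psi> A)" and two: "\<psi> (-2) = -2" and ne: "\<not> (x = 0 \<and> y = 0 \<and> z = 0)"
  shows "\<psi> u * x * y + \<psi> a * x * z + \<psi> b * y * z < x\<^sup>2 + y\<^sup>2 + z\<^sup>2"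
proof -
  define v where "v = vec 3 (\<lambda>i::nat. if i = 0 then x else if i = Suc 0 then y else z)"
  have "v \<noteq> 0\<^sub>v 3"
  proof
    assume v: "v = 0\<^sub>v 3"
    show False using ne arg_cong[OF v, of "\<lambda>w. w $ 0"] arg_cong[OF v, of "\<lambda>w. w $ 1"] arg_cong[OF v, of "\<lambda>w. w $ 2"]
      by (simp add: v_def)
  qed
  moreover have "v \<in> carrier_vec 3" by (simp add: v_def)
  ultimately have "v \<bullet> (map_mat \<psi> A *\<^sub>v v) < 0"
    using nd unfolding neg_definite_def A_def by (simp add: tri_matrix_simps)
  moreover have "v \<bullet> (map_mat \<psi> A *\<^sub>v v) = 
      - 2 * (x\<^sup>2 + y\<^sup>2 + z\<^sup>2) + 2 * (\<psi> u * x * y + \<psi> a * x * z + \<psi> b * y * z)"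
  proof -
    have sum3: "sum f {0..<3} = f 0 + f (Suc 0) + f 2" for f :: "nat \<Rightarrow> real"
      by (simp add: numeral_3_eq_3 numeral_2_eq_2)
    show ?thesis
      by (simp add: v_def A_def scalar_prod_def sum3 tri_matrix_simps two a_def b_def
          power2_eq_square algebra_simps)
  qed
  ultimately show ?thesis by argo
qed

text \<open>The determinant of the conjugate matrix is -2 times the difference of the two sides,
  right minus left, so this is its sign condition, extracted from a single test vector.\<close>

lemma neg_definite_tri_matrix_det:
  assumes nd: "neg_definite (map_mat \<psi> A)" and two: "\<psi> (-2) = -2"
  shows "(\<psi> u)\<^sup>2 + \<psi> u * \<psi> a * \<psi> b + (\<psi> a)\<^sup>2 + (\<psi> b)\<^sup>2 < 4"
proof -
  define t where "t = \<psi> u"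
  note Q = neg_definite_tri_matrix[OF assms, folded t_def]
  \<comment> \<open>The test vectors (1, 1, 0) and (1, -1, 0).\<close>
  have "t < 2" "- 2 < t" using Q[of 1 1 0] Q[of 1 "-1" 0] by auto
  then have "0 < (2 - t) * (2 + t)" by simp
  then have pos: "4 - t\<^sup>2 > 0" by (simp add: power2_eq_square algebra_simps)
  define x y z where "x = 2 * \<psi> a + t * \<psi> b" and "y = 2 * \<psi> b + t * \<psi> a" and "z = 4 - t\<^sup>2"
  \<comment> \<open>the vector minimising the form for fixed \<open>z\<close>\<close>
  have "t * x * y + \<psi> a * x * z + \<psi> b * y * z < x\<^sup>2 + y\<^sup>2 + z\<^sup>2"
    using Q[of x y z] pos by (simp add: z_def)
  then have "0 < x\<^sup>2 + y\<^sup>2 + z\<^sup>2 - (t * x * y + \<psi> a * x * z + \<psi> b * y * z)" by simp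
  also have "\<dots> = (4 - t\<^sup>2) * (4 - (t\<^sup>2 + t * \<psi> a * \<psi> b + (\<psi> a)\<^sup>2 + (\<psi> b)\<^sup>2))"
    unfolding x_def y_def z_def by (simp add: power2_eq_square algebra_simps)
  finally show ?thesis using pos by (simp add: zero_less_mult_iff t_def)
qed

text \<open>\<open>v_arithmetic\<close> speaks of real embeddings of \<open>L\<close>, but
  \<open>\<phi>\<close> is a complex embedding of \<open>K\<close>. It is extended to
  \<open>K(sqrt 2)\<close>, which contains \<open>L\<close>; total reality puts the image of
  \<open>L\<close> into the reals, and the restriction to \<open>K\<close> is still not the
  identity.\<close>

lemma real_conjugate:
  assumes va: "v_arithmetic A" and ent: "u \<in> adjoin K (sqrt 2)" "a \<in> adjoin K (sqrt 2)" "b \<in> adjoin K (sqrt 2)"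
    and \<phi>: "hom_on K \<phi>" "\<exists>x\<in>K. \<phi> x \<noteq> complex_of_real x"
  obtains \<psi> :: "real \<Rightarrow> real" where "hom_on L \<psi>" "\<And>x. x \<in> K \<Longrightarrow> \<phi> x = of_real (\<psi> x)"
    "(\<psi> u)\<^sup>2 + \<psi> u * \<psi> a * \<psi> b + (\<psi> a)\<^sup>2 + (\<psi> b)\<^sup>2 < 4"
proof -
  note K = is_subfield_ground_field and L = is_subfield_entry_field
  have r2: "sqrt 2 * sqrt 2 \<in> K" using subfield_numeral[OF K] by simp
  have L_sub: "L \<subseteq> adjoin K (sqrt 2)"
    by (rule entry_field_least[OF is_subfield_adjoin[OF K r2] ent])
  have "\<exists>\<chi>. hom_on (adjoin K (sqrt 2)) \<chi> \<and> (\<forall>x\<in>K. \<chi> x = \<phi> x)"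
  proof (cases "sqrt 2 \<in> K")
    case True
    then have "adjoin K (sqrt 2) \<subseteq> K" by (intro adjoin_least[OF K]) auto
    then show ?thesis using \<phi>(1) hom_on_subset by blast
  next
    case False
    \<comment> \<open>2 is fixed by \<open>\<phi>\<close>, so \<open>sqrt 2\<close> itself can serve
      as the image of the adjoined root.\<close>
    have "\<phi> (sqrt 2 * sqrt 2) = complex_of_real (sqrt 2) * complex_of_real (sqrt 2)"
      using hom_onD(8)[OF K \<phi>(1), of 2] by (simp flip: of_real_mult)
    then have "hom_on (adjoin K (sqrt 2)) (extend_hom K (sqrt 2) \<phi> (complex_of_real (sqrt 2)))"
      by (rule hom_on_extend_hom[OF K False r2 \<phi>(1)])
    then show ?thesis using extend_hom_base[OF K False] hom_onD(1)[OF K \<phi>(1)] by blast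
  qed
  then obtain \<chi> where "hom_on (adjoin K (sqrt 2)) \<chi>" and ext: "\<And>x. x \<in> K \<Longrightarrow> \<chi> x = \<phi> x" by blast
  then have \<chi>: "hom_on L \<chi>" using L_sub hom_on_subset by blast
  then have "\<forall>x\<in>L. \<chi> x \<in> \<real>" using va unfolding v_arithmetic_def totally_real_def L_def by blast
  then have re: "\<chi> x = of_real (Re (\<chi> x))" if "x \<in> L" for x using that by (simp add: complex_is_Real_iff complex_eq_iff)
  define \<psi> where "\<psi> = (\<lambda>x. Re (\<chi> x))"
  have \<psi>: "hom_on L \<psi>" unfolding hom_on_def
  proof (intro conjI ballI)
    show "\<psi> 1 = 1" using hom_onD(2)[OF L \<chi>] by (simp add: \<psi>_def)
    fix x y assume xy: "x \<in> L" "y \<in> L"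
    show "\<psi> (x + y) = \<psi> x + \<psi> y" using hom_onD(3)[OF L \<chi> xy] by (simp add: \<psi>_def)
    have "Im (\<chi> x) = 0" "Im (\<chi> y) = 0" using re xy by (metis Im_complex_of_real)+
    then show "\<psi> (x * y) = \<psi> x * \<psi> y" using hom_onD(4)[OF L \<chi> xy] by (simp add: \<psi>_def)
  qed
  have eq: "\<phi> x = of_real (\<psi> x)" if "x \<in> K" for x
    using ext[OF that] re[of x] that ground_field_subset_entry_field by (auto simp: \<psi>_def)
  have "\<exists>x\<in>K. \<psi> x \<noteq> x" using \<phi>(2) eq by auto
  then have "neg_definite (map_mat \<psi> A)"
    using va \<psi> unfolding v_arithmetic_def L_def K_def by blast
  moreover have "\<psi> (-2) = -2" using hom_onD(8)[OF L \<psi>, of "-2"] by simp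
  ultimately show ?thesis using that[OF \<psi> eq] neg_definite_tri_matrix_det by blast
qed

text \<open>The common frame of the six cases, which supply the embeddings, \<open>h\<close>, and
  its bounds \<open>R\<close> at the identity and \<open>\<rho>\<close> elsewhere. From
  \<open>length \<Phi> < D\<close> it follows that at most \<open>D\<close> reals span
  \<open>K\<close> over the rationals.\<close>

lemma card_indep_le:
  assumes va: "v_arithmetic A" and ent: "u \<in> adjoin K (sqrt 2)" "a \<in> adjoin K (sqrt 2)" "b \<in> adjoin K (sqrt 2)"
    and fam: "norm_family K \<Phi>" and h: "h \<in> K" "algebraic_int h" "h \<noteq> 0"
    and id: "\<bar>h\<bar> \<le> R" and \<rho>: "0 \<le> \<rho>" "\<rho> \<le> 1" "R * \<rho> ^ D < 1"
    and bnd: "\<And>\<psi> :: real \<Rightarrow> real. hom_on L \<psi> \<Longrightarrow> (\<psi> u)\<^sup>2 + \<psi> u * \<psi> a * \<psi> b + (\<psi> a)\<^sup>2 + (\<psi> b)\<^sup>2 < 4 \<Longrightarrow> \<bar>\<psi> h\<bar> \<le> \<rho>"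
    and B: "finite B" "B \<subseteq> K" "lin_indep_over \<rat> B"
  shows "card B \<le> D"
proof -
  have "length \<Phi> < D"
  proof (rule norm_family_length_less[OF fam h id \<rho>])
    fix \<phi> assume "\<phi> \<in> set \<Phi>"
    then have \<phi>: "hom_on K \<phi>" "\<exists>x\<in>K. \<phi> x \<noteq> complex_of_real x" using fam by (auto simp: norm_family_def)
    obtain \<psi> :: "real \<Rightarrow> real" where "hom_on L \<psi>" "\<And>x. x \<in> K \<Longrightarrow> \<phi> x = of_real (\<psi> x)"
      "(\<psi> u)\<^sup>2 + \<psi> u * \<psi> a * \<psi> b + (\<psi> a)\<^sup>2 + (\<psi> b)\<^sup>2 < 4"
      using real_conjugate[OF va ent \<phi>] by metis
    then show "cmod (\<phi> h) \<le> \<rho>" using bnd[of \<psi>] h(1) by simp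
  qed
  moreover obtain S where "finite S" "card S \<le> Suc (length \<Phi>)" "K \<subseteq> rat_real.span S"
    using fam by (auto simp: norm_family_def)
  ultimately show ?thesis using card_le_of_lin_indep_Rats[of S B] B by fastforce
qed

lemma quadratic_element:
  shows "u\<^sup>2 + u * a * b \<in> K"
    and "algebraic_int u \<Longrightarrow> algebraic_int a \<Longrightarrow> algebraic_int b \<Longrightarrow> algebraic_int (u\<^sup>2 + u * a * b)"
    and "hom_on L \<psi> \<Longrightarrow> \<psi> (u\<^sup>2 + u * a * b) = (\<psi> u)\<^sup>2 + \<psi> u * \<psi> a * \<psi> b"
proof -
  show "u\<^sup>2 + u * a * b \<in> K"
    using cyclic_products_in_ground_field subfieldD(3)[OF is_subfield_ground_field] by blast
  show "algebraic_int u \<Longrightarrow> algebraic_int a \<Longrightarrow> algebraic_int b \<Longrightarrow> algebraic_int (u\<^sup>2 + u * a * b)"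
    by (intro algebraic_int_add algebraic_int_mult algebraic_int_power)
  show "hom_on L \<psi> \<Longrightarrow> \<psi> (u\<^sup>2 + u * a * b) = (\<psi> u)\<^sup>2 + \<psi> u * \<psi> a * \<psi> b"
    using entries_in_entry_field
    by (simp add: hom_onD[OF is_subfield_entry_field] subfield_intros[OF is_subfield_entry_field])
qed

lemma quadratic_lower_bound: "- ((y * z)\<^sup>2 / 4) \<le> x\<^sup>2 + x * y * (z::real)"
  using zero_le_power2[of "2 * x + y * z"] by (simp add: power2_eq_square algebra_simps)

section \<open>The six pairs (s, k)\<close>

lemma card_indep_le_3_3:
  assumes sk: "s = 3" "k = 3" and va: "v_arithmetic A" and u: "algebraic_int u" "2 < u" "u < 14"
    and B: "finite B" "B \<subseteq> K" "lin_indep_over \<rat> B"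
  shows "card B \<le> 23"
proof -
  note K = is_subfield_ground_field and L = is_subfield_entry_field
  have ab: "a = 1" "b = 1" by (simp_all add: a_def b_def sk cos_60)
  have uK: "u \<in> K" using cyclic_products_in_ground_field(4) by (simp add: ab)
  have F: "is_subfield (simple_field u)" by (rule is_subfield_simple_field[OF u(1)])
  have "K = simple_field u"
    by (rule ground_field_eqI[OF F simple_field_least[OF K uK], of 1 1 1])
       (simp_all add: ab mem_simple_field subfieldD[OF F])
  then obtain \<Phi> where fam: "norm_family K \<Phi>" using norm_family_simple_field[OF u(1)] by metis
  define q where "q = u\<^sup>2 + u * a * b"
  define h where "h = q ^ 4 * (q - 1) ^ 3 * (q - 2) ^ 3"
  have q: "q \<in> K" "algebraic_int q" unfolding q_def using quadratic_element u(1) ab by auto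
  have "u * u > 4" "u * u < 196" using u mult_strict_mono[of 2 u 2 u] mult_strict_mono[of u 14 u 14] by auto
  then have q_le: "6 < q" "q < 210" using u by (auto simp: q_def ab power2_eq_square)
  show ?thesis
  proof (rule card_indep_le[OF va _ _ _ fam _ _ _ _ _ _ _ _ B, where \<rho> = "92 / 1000" and h = h])
    show "u \<in> adjoin K (sqrt 2)" "a \<in> adjoin K (sqrt 2)" "b \<in> adjoin K (sqrt 2)"
      using subset_adjoin[OF K, of "sqrt 2"] uK subfieldD[OF K] by (auto simp: ab)
    show "h \<in> K" unfolding h_def using q by (intro subfield_intros[OF K])
    show "algebraic_int h" unfolding h_def using q(2)
      by (intro algebraic_int_mult algebraic_int_power algebraic_int_diff) auto
    show "h \<noteq> 0" using q_le by (simp add: h_def)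
    show "\<bar>h\<bar> \<le> 210 ^ 4 * 209 ^ 3 * 208 ^ 3"
      unfolding h_def abs_mult power_abs using q_le by (intro mult_mono power_mono) auto
    \<comment> \<open>23 is the least exponent that brings this product below 1.\<close>
    show "210 ^ 4 * 209 ^ 3 * 208 ^ 3 * (92 / 1000) ^ 23 < (1::real)" by (simp add: power_divide)
    fix \<psi> :: "real \<Rightarrow> real"
    assume \<psi>: "hom_on L \<psi>" and lt: "(\<psi> u)\<^sup>2 + \<psi> u * \<psi> a * \<psi> b + (\<psi> a)\<^sup>2 + (\<psi> b)\<^sup>2 < 4"
    have qL: "q \<in> L" using q(1) ground_field_subset_entry_field by blast
    have ab': "\<psi> a = 1" "\<psi> b = 1" by (simp_all add: ab hom_onD[OF L \<psi>])
    have q': "\<psi> q = (\<psi> u)\<^sup>2 + \<psi> u * \<psi> a * \<psi> b" unfolding q_def by (rule quadratic_element(3)[OF \<psi>])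
    have "\<psi> h = \<psi> q ^ 4 * (\<psi> q - 1) ^ 3 * (\<psi> q - 2) ^ 3"
      unfolding h_def using qL by (simp add: hom_onD[OF L \<psi>] hom_on_numeral[OF L \<psi>] subfield_intros[OF L])
    then show "\<bar>\<psi> h\<bar> \<le> 92 / 1000"
      using aux_bound_3_3[of "\<psi> q"] quadratic_lower_bound[of "\<psi> a" "\<psi> b" "\<psi> u"] lt by (simp add: q' ab')
  qed auto
qed

text \<open>Here \<open>u\<close> is only known to lie in \<open>K(sqrt 2)\<close>; the generator of
  \<open>K\<close> is the cyclic product \<open>w = sqrt 2 * u\<close>.\<close>

lemma card_indep_le_3_4:
  assumes sk: "s = 3" "k = 4" and va: "v_arithmetic A" and u: "algebraic_int u" "2 < u" "u < 14"
    and B: "finite B" "B \<subseteq> K" "lin_indep_over \<rat> B"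
  shows "card B \<le> 12"
proof -
  note K = is_subfield_ground_field and L = is_subfield_entry_field
  have ab: "a = 1" "b = sqrt 2" by (simp_all add: a_def b_def sk cos_60 cos_45)
  have b: "algebraic_int b" unfolding ab by (intro algebraic_int_sqrt) simp
  define w where "w = sqrt 2 * u"
  have w: "algebraic_int w" unfolding w_def using u(1) b[unfolded ab] by (intro algebraic_int_mult)
  have wK: "w \<in> K" using cyclic_products_in_ground_field(4) by (simp add: ab w_def mult.commute)
  have F: "is_subfield (simple_field w)" by (rule is_subfield_simple_field[OF w])
  have u_eq: "u = 0 + w / 2 * sqrt 2" by (simp add: w_def)
  have "K = simple_field w"
  \<comment> \<open>Conjugating by the diagonal matrix with entries 1, \<open>sqrt 2\<close>, 1
    turns \<open>u\<close> into \<open>w / 2\<close> and \<open>w\<close>, and \<open>b\<close> into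
    2 and 1.\<close>
  proof (rule ground_field_eqI[OF F simple_field_least[OF K wK], of 1 "sqrt 2" 1])
    have "1 * u / sqrt 2 = w / 2" by (simp add: w_def field_simps)
    then show "1 * u / sqrt 2 \<in> simple_field w"
      using subfield_divide[OF F mem_simple_field subfield_numeral[OF F]] by metis
    show "sqrt 2 * u / 1 \<in> simple_field w" using mem_simple_field[of w] by (simp add: w_def)
  qed (simp_all add: ab subfieldD[OF F] subfield_numeral[OF F])
  then obtain \<Phi> where fam: "norm_family K \<Phi>" using norm_family_simple_field[OF w] by metis
  define q where "q = u\<^sup>2 + u * a * b"
  define h where "h = q ^ 4 * (q - 1)"
  have q: "q \<in> K" "algebraic_int q" unfolding q_def using quadratic_element u(1) b ab by auto
  have "u * u > 4" "u * u < 196" using u mult_strict_mono[of 2 u 2 u] mult_strict_mono[of u 14 u 14] by auto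
  moreover have "sqrt 2 < 142 / 100" by (rule real_less_lsqrt) (auto simp: power2_eq_square)
  then have "0 < u * sqrt 2" "u * sqrt 2 < 14 * (142 / 100)" using u mult_strict_mono[of u 14 "sqrt 2" "142/100"] by auto
  ultimately have q_le: "4 < q" "q < 216" unfolding q_def ab power2_eq_square by linarith+
  show ?thesis
  proof (rule card_indep_le[OF va _ _ _ fam _ _ _ _ _ _ _ _ B, where \<rho> = "3 / 32" and h = h])
    show "u \<in> adjoin K (sqrt 2)" by (subst u_eq) (intro adjoinI subfield_intros[OF K] wK)
    show "a \<in> adjoin K (sqrt 2)" "b \<in> adjoin K (sqrt 2)"
      using subset_adjoin[OF K, of "sqrt 2"] root_mem_adjoin[OF K] subfieldD[OF K] by (auto simp: ab)
    show "h \<in> K" unfolding h_def using q by (intro subfield_intros[OF K])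
    show "algebraic_int h" unfolding h_def using q(2)
      by (intro algebraic_int_mult algebraic_int_power algebraic_int_diff) auto
    show "h \<noteq> 0" using q_le by (simp add: h_def)
    show "\<bar>h\<bar> \<le> 216 ^ 4 * 215"
      unfolding h_def abs_mult power_abs using q_le by (intro mult_mono power_mono) auto
    show "216 ^ 4 * 215 * (3 / 32) ^ 12 < (1::real)" by (simp add: power_divide)
    fix \<psi> :: "real \<Rightarrow> real"
    assume \<psi>: "hom_on L \<psi>" and lt: "(\<psi> u)\<^sup>2 + \<psi> u * \<psi> a * \<psi> b + (\<psi> a)\<^sup>2 + (\<psi> b)\<^sup>2 < 4"
    have qL: "q \<in> L" using q(1) ground_field_subset_entry_field by blast
    have a': "\<psi> a = 1" by (simp add: ab hom_onD[OF L \<psi>])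
    have b': "(\<psi> b)\<^sup>2 = 2"
      using hom_onD(7)[OF L \<psi> entries_in_entry_field(3), of 2] by (simp add: ab hom_on_numeral[OF L \<psi>])
    have q': "\<psi> q = (\<psi> u)\<^sup>2 + \<psi> u * \<psi> a * \<psi> b" unfolding q_def by (rule quadratic_element(3)[OF \<psi>])
    have "\<psi> h = \<psi> q ^ 4 * (\<psi> q - 1)"
      unfolding h_def using qL by (simp add: hom_onD[OF L \<psi>] hom_on_numeral[OF L \<psi>] subfield_intros[OF L])
    then show "\<bar>\<psi> h\<bar> \<le> 3 / 32"
      using aux_bound_3_4[of "\<psi> q"] quadratic_lower_bound[of "\<psi> a" "\<psi> b" "\<psi> u"] lt by (simp add: q' a' b')
  qed auto
qed

lemma card_indep_le_4_4:
  assumes sk: "s = 4" "k = 4" and va: "v_arithmetic A" and u: "algebraic_int u" "2 < u" "u < 14"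
    and B: "finite B" "B \<subseteq> K" "lin_indep_over \<rat> B"
  shows "card B \<le> 8"
proof -
  note K = is_subfield_ground_field and L = is_subfield_entry_field
  have ab: "a = sqrt 2" "b = sqrt 2" by (simp_all add: a_def b_def sk cos_45)
  have b: "algebraic_int (sqrt (2::real))" by (intro algebraic_int_sqrt) simp
  \<comment> \<open>The cyclic product \<open>u * a * b\<close> equals \<open>2 * u\<close>.\<close>
  have uK: "u \<in> K" using subfield_divide[OF K cyclic_products_in_ground_field(4) subfield_numeral[OF K, of "num.Bit0 num.One"]]
    by (simp add: ab mult.assoc)
  have F: "is_subfield (simple_field u)" by (rule is_subfield_simple_field[OF u(1)])
  have "K = simple_field u"
    \<comment> \<open>The scaling 1, 1, \<open>sqrt 2\<close> leaves \<open>u\<close> alone and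
      turns \<open>a\<close> and \<open>b\<close> into 1 and 2.\<close>
    by (rule ground_field_eqI[OF F simple_field_least[OF K uK], of 1 1 "sqrt 2"])
       (simp_all add: ab mem_simple_field subfieldD[OF F] subfield_numeral[OF F])
  then obtain \<Phi> where fam: "norm_family K \<Phi>" using norm_family_simple_field[OF u(1)] by metis
  define q where "q = u\<^sup>2 + u * a * b"
  define h where "h = q * (q + 1)"
  have q: "q \<in> K" "algebraic_int q" unfolding q_def using quadratic_element u(1) b ab by auto
  have "u * u > 4" "u * u < 196" using u mult_strict_mono[of 2 u 2 u] mult_strict_mono[of u 14 u 14] by auto
  then have q_le: "4 < q" "q < 224" using u by (auto simp: q_def ab power2_eq_square mult.assoc)
  show ?thesis
  proof (rule card_indep_le[OF va _ _ _ fam _ _ _ _ _ _ _ _ B, where \<rho> = "1 / 4" and h = h])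
    show "u \<in> adjoin K (sqrt 2)" "a \<in> adjoin K (sqrt 2)" "b \<in> adjoin K (sqrt 2)"
      using subset_adjoin[OF K, of "sqrt 2"] uK root_mem_adjoin[OF K] by (auto simp: ab)
    show "h \<in> K" unfolding h_def using q by (intro subfield_intros[OF K])
    show "algebraic_int h" unfolding h_def using q(2)
      by (intro algebraic_int_mult algebraic_int_add) auto
    show "h \<noteq> 0" using q_le by (simp add: h_def)
    show "\<bar>h\<bar> \<le> 224 * 225"
      unfolding h_def abs_mult using q_le by (intro mult_mono) auto
    show "224 * 225 * (1 / 4) ^ 8 < (1::real)" by (simp add: power_divide)
    fix \<psi> :: "real \<Rightarrow> real"
    assume \<psi>: "hom_on L \<psi>" and lt: "(\<psi> u)\<^sup>2 + \<psi> u * \<psi> a * \<psi> b + (\<psi> a)\<^sup>2 + (\<psi> b)\<^sup>2 < 4"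
    have qL: "q \<in> L" using q(1) ground_field_subset_entry_field by blast
    have b': "(\<psi> b)\<^sup>2 = 2" "\<psi> a = \<psi> b"
      using hom_onD(7)[OF L \<psi> entries_in_entry_field(3), of 2] by (simp_all add: ab hom_on_numeral[OF L \<psi>])
    have q': "\<psi> q = (\<psi> u)\<^sup>2 + \<psi> u * \<psi> a * \<psi> b" unfolding q_def by (rule quadratic_element(3)[OF \<psi>])
    have "\<psi> h = \<psi> q * (\<psi> q + 1)"
      unfolding h_def using qL by (simp add: hom_onD[OF L \<psi>] subfield_intros[OF L])
    then show "\<bar>\<psi> h\<bar> \<le> 1 / 4"
      using aux_bound_4_4[of "\<psi> q"] quadratic_lower_bound[of "\<psi> a" "\<psi> b" "\<psi> u"] lt
      by (simp add: q' b' power_mult_distrib)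
  qed auto
qed

lemma card_indep_le_3_5:
  assumes sk: "s = 3" "k = 5" and va: "v_arithmetic A" and u: "algebraic_int u" "2 < u" "u < 14"
    and B: "finite B" "B \<subseteq> K" "lin_indep_over \<rat> B"
  shows "card B \<le> 15"
proof -
  note K = is_subfield_ground_field and L = is_subfield_entry_field
  have b: "b\<^sup>2 = b + 1" "sqrt 5 = 2 * b - 1" "0 < b" using two_cos_pi_5 by (simp_all add: b_def sk)
  have b_le: "1618 / 1000 < b" "b < 16181 / 10000" using b(1,3) by (cases rule: golden_cases; simp)+
  have b_eq: "b = (1 + sqrt 5) / 2" using b(2) by simp
  have b_int: "algebraic_int b"
    by (rule algebraic_int.intros[of "[:-1, -1, 1:]"]) (use b(1) in \<open>auto simp: coeff_pCons power2_eq_square algebra_simps split: nat.splits\<close>)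
  \<comment> \<open>The golden ratio relation gives \<open>b\<close> as
    \<open>b\<^sup>2 - 1\<close>, and \<open>b\<^sup>2\<close> is a cyclic product.\<close>
  have bK: "b \<in> K" using subfield_diff[OF K cyclic_products_in_ground_field(3) subfieldD(2)[OF K]] b(1) by simp
  have "sqrt 5 \<in> K" unfolding b(2) using bK by (intro subfield_intros[OF K])
  have a: "a = 1" by (simp add: a_def sk cos_60)
  have a_int: "algebraic_int a" by (simp add: a)
  have uK: "u \<in> K"
    using subfield_divide[OF K cyclic_products_in_ground_field(4) bK] b(3) by (simp add: a)
  have F0: "is_subfield (simple_field u)" by (rule is_subfield_simple_field[OF u(1)])
  define F where "F = adjoin (simple_field u) (sqrt 5)"
  have F: "is_subfield F" unfolding F_def using subfield_numeral[OF F0] by (intro is_subfield_adjoin[OF F0]) simp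
  have uF: "u \<in> F" using subset_adjoin[OF F0, of "sqrt 5"] mem_simple_field[of u] by (auto simp: F_def)
  have bF: "b \<in> F" unfolding b_eq using root_mem_adjoin[OF F0] by (intro subfield_intros[OF F]) (simp add: F_def)
  have F_sub: "F \<subseteq> K" unfolding F_def
    by (rule adjoin_least[OF K simple_field_least[OF K uK] \<open>sqrt 5 \<in> K\<close>])
  have "K = F" by (rule ground_field_eqI[OF F F_sub, of 1 1 1]) (simp_all add: a uF bF subfieldD[OF F])
  then obtain \<Phi> where fam: "norm_family K \<Phi>"
    using norm_family_adjoin_sqrt[OF u(1), of 5] unfolding F_def by auto
  define q where "q = u\<^sup>2 + u * a * b"
  define h where "h = b ^ 3 * ((q + b - 1) * q * (q + b - 2))"
  have q: "q \<in> K" "algebraic_int q" unfolding q_def using quadratic_element u(1) a_int b_int by auto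
  have "u * u > 4" "u * u < 196" using u mult_strict_mono[of 2 u 2 u] mult_strict_mono[of u 14 u 14] by auto
  moreover have "0 < u * b" "u * b < 14 * (16181 / 10000)"
    using u b_le mult_strict_mono[of u 14 b "16181/10000"] by auto
  ultimately have q_le: "4 < q" "q < 218.7" using u by (auto simp: q_def a power2_eq_square)
  show ?thesis
  proof (rule card_indep_le[OF va _ _ _ fam _ _ _ _ _ _ _ _ B, where \<rho> = "305 / 1000" and h = h])
    show "u \<in> adjoin K (sqrt 2)" "a \<in> adjoin K (sqrt 2)" "b \<in> adjoin K (sqrt 2)"
      using subset_adjoin[OF K, of "sqrt 2"] uK bK subfieldD[OF K] by (auto simp: a)
    show "h \<in> K" unfolding h_def using q bK by (intro subfield_intros[OF K])
    show "algebraic_int h" unfolding h_def using q(2) b_int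
      by (intro algebraic_int_mult algebraic_int_power algebraic_int_diff algebraic_int_add) auto
    show "h \<noteq> 0" using q_le b_le by (simp add: h_def)
    show "\<bar>h\<bar> \<le> 42363 / 10000 * (219.4 * 218.7 * 218.4)"
      unfolding h_def abs_mult using q_le b_le by (intro mult_mono) (auto simp: golden_powers[OF b(1)])
    show "42363 / 10000 * (219.4 * 218.7 * 218.4) * (305 / 1000) ^ 15 < (1::real)" by (simp add: power_divide)
    fix \<psi> :: "real \<Rightarrow> real"
    assume \<psi>: "hom_on L \<psi>" and lt: "(\<psi> u)\<^sup>2 + \<psi> u * \<psi> a * \<psi> b + (\<psi> a)\<^sup>2 + (\<psi> b)\<^sup>2 < 4"
    have qL: "q \<in> L" "b \<in> L" using q(1) bK ground_field_subset_entry_field by blast+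
    have "\<psi> (b\<^sup>2) = \<psi> (b + 1)" using b(1) by simp
    then have b': "(\<psi> b)\<^sup>2 = \<psi> b + 1" using qL by (simp add: hom_onD[OF L \<psi>] subfieldD[OF L])
    have a': "\<psi> a = 1" by (simp add: a hom_onD[OF L \<psi>])
    have q': "\<psi> q = (\<psi> u)\<^sup>2 + \<psi> u * \<psi> a * \<psi> b" unfolding q_def by (rule quadratic_element(3)[OF \<psi>])
    have "\<psi> h = \<psi> b ^ 3 * ((\<psi> q + \<psi> b - 1) * \<psi> q * (\<psi> q + \<psi> b - 2))"
      unfolding h_def using qL by (simp add: hom_onD[OF L \<psi>] hom_on_numeral[OF L \<psi>] subfield_intros[OF L])
    moreover have "(\<psi> a * \<psi> b)\<^sup>2 = \<psi> b + 1" by (simp add: a' b')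
    then have "- (\<psi> b + 1) / 4 \<le> \<psi> q" using quadratic_lower_bound[of "\<psi> a" "\<psi> b" "\<psi> u"] unfolding q' by argo
    moreover have "\<psi> q \<le> 2 - \<psi> b" using lt by (simp add: q' a' b')
    ultimately show "\<bar>\<psi> h\<bar> \<le> 305 / 1000"
      using aux_bound_3_5[OF b', of "\<psi> q"] by simp
  qed auto
qed

lemma card_indep_le_4_5:
  assumes sk: "s = 4" "k = 5" and va: "v_arithmetic A" and u: "algebraic_int u" "2 < u" "u < 14"
    and B: "finite B" "B \<subseteq> K" "lin_indep_over \<rat> B"
  shows "card B \<le> 23"
proof -
  note K = is_subfield_ground_field and L = is_subfield_entry_field
  have b: "b\<^sup>2 = b + 1" "sqrt 5 = 2 * b - 1" "0 < b" using two_cos_pi_5 by (simp_all add: b_def sk)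
  have b_le: "1618 / 1000 < b" "b < 16181 / 10000" using b(1,3) by (cases rule: golden_cases; simp)+
  have b_eq: "b = (1 + sqrt 5) / 2" using b(2) by simp
  have b_int: "algebraic_int b"
    by (rule algebraic_int.intros[of "[:-1, -1, 1:]"]) (use b(1) in \<open>auto simp: coeff_pCons power2_eq_square algebra_simps split: nat.splits\<close>)
  have bK: "b \<in> K" using subfield_diff[OF K cyclic_products_in_ground_field(3) subfieldD(2)[OF K]] b(1) by simp
  have "sqrt 5 \<in> K" unfolding b(2) using bK by (intro subfield_intros[OF K])
  have a: "a = sqrt 2" by (simp add: a_def sk cos_45)
  have a_int: "algebraic_int a" unfolding a by (intro algebraic_int_sqrt) simp
  define w where "w = sqrt 2 * u"
  have w: "algebraic_int w" unfolding w_def using u(1) a_int[unfolded a] by (intro algebraic_int_mult)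
  have wK: "w \<in> K"
    using subfield_divide[OF K cyclic_products_in_ground_field(4) bK] b(3) by (simp add: a w_def mult.commute)
  have u_eq: "u = 0 + w / 2 * sqrt 2" by (simp add: w_def)
  have F0: "is_subfield (simple_field w)" by (rule is_subfield_simple_field[OF w])
  define F where "F = adjoin (simple_field w) (sqrt 5)"
  have F: "is_subfield F" unfolding F_def using subfield_numeral[OF F0] by (intro is_subfield_adjoin[OF F0]) simp
  have wF: "w \<in> F" using subset_adjoin[OF F0, of "sqrt 5"] mem_simple_field[of w] by (auto simp: F_def)
  have bF: "b \<in> F" unfolding b_eq using root_mem_adjoin[OF F0] by (intro subfield_intros[OF F]) (simp add: F_def)
  have F_sub: "F \<subseteq> K" unfolding F_def
    by (rule adjoin_least[OF K simple_field_least[OF K wK] \<open>sqrt 5 \<in> K\<close>])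
  have "K = F"
  \<comment> \<open>The scaling \<open>sqrt 2\<close>, 1, 1 turns \<open>u\<close> into
    \<open>w\<close> and \<open>w / 2\<close>, \<open>a\<close> into 2 and 1, and leaves
    \<open>b\<close> alone.\<close>
  proof (rule ground_field_eqI[OF F F_sub, of "sqrt 2" 1 1])
    have "1 * u / sqrt 2 = w / 2" by (simp add: w_def field_simps)
    then show "1 * u / sqrt 2 \<in> F" using subfield_divide[OF F wF subfield_numeral[OF F]] by metis
    show "sqrt 2 * u / 1 \<in> F" using wF by (simp add: w_def)
  qed (simp_all add: a bF subfieldD[OF F] subfield_numeral[OF F])
  then obtain \<Phi> where fam: "norm_family K \<Phi>"
    using norm_family_adjoin_sqrt[OF w, of 5] unfolding F_def by auto
  define q where "q = u\<^sup>2 + u * a * b"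
  define h where "h = q * (q + b) * (q + b - 1)"
  have q: "q \<in> K" "algebraic_int q" unfolding q_def using quadratic_element u(1) a_int b_int by auto
  have "u * u > 4" "u * u < 196" using u mult_strict_mono[of 2 u 2 u] mult_strict_mono[of u 14 u 14] by auto
  moreover have "sqrt 2 < 142 / 100" by (rule real_less_lsqrt) (auto simp: power2_eq_square)
  then have "u * a < 14 * (142 / 100)" "0 < u * a" using u mult_strict_mono[of u 14 "sqrt 2" "142/100"] by (auto simp: a)
  then have "0 < u * a * b" "u * a * b < 14 * (142 / 100) * (16181 / 10000)"
    using b_le mult_strict_mono[of "u * a" "14 * (142 / 100)" b "16181/10000"] by auto
  ultimately have q_le: "4 < q" "q < 229" using u by (auto simp: q_def power2_eq_square)
  show ?thesis
  proof (rule card_indep_le[OF va _ _ _ fam _ _ _ _ _ _ _ _ B, where \<rho> = "4 / 10" and h = h])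
    show "u \<in> adjoin K (sqrt 2)" by (subst u_eq) (intro adjoinI subfield_intros[OF K] wK)
    show "a \<in> adjoin K (sqrt 2)" "b \<in> adjoin K (sqrt 2)"
      using subset_adjoin[OF K, of "sqrt 2"] root_mem_adjoin[OF K] bK by (auto simp: a)
    show "h \<in> K" unfolding h_def using q bK by (intro subfield_intros[OF K])
    show "algebraic_int h" unfolding h_def using q(2) b_int
      by (intro algebraic_int_mult algebraic_int_power algebraic_int_diff algebraic_int_add) auto
    show "h \<noteq> 0" using q_le b_le by (simp add: h_def)
    show "\<bar>h\<bar> \<le> 229 * 231 * 230"
      unfolding h_def abs_mult using q_le b_le by (intro mult_mono) (auto simp: golden_powers[OF b(1)])
    show "229 * 231 * 230 * (4 / 10) ^ 23 < (1::real)" by (simp add: power_divide)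
    fix \<psi> :: "real \<Rightarrow> real"
    assume \<psi>: "hom_on L \<psi>" and lt: "(\<psi> u)\<^sup>2 + \<psi> u * \<psi> a * \<psi> b + (\<psi> a)\<^sup>2 + (\<psi> b)\<^sup>2 < 4"
    have qL: "q \<in> L" "b \<in> L" using q(1) bK ground_field_subset_entry_field by blast+
    have "\<psi> (b\<^sup>2) = \<psi> (b + 1)" using b(1) by simp
    then have b': "(\<psi> b)\<^sup>2 = \<psi> b + 1" using qL by (simp add: hom_onD[OF L \<psi>] subfieldD[OF L])
    have a': "(\<psi> a)\<^sup>2 = 2"
      using hom_onD(7)[OF L \<psi> entries_in_entry_field(2), of 2] by (simp add: a hom_on_numeral[OF L \<psi>])
    have q': "\<psi> q = (\<psi> u)\<^sup>2 + \<psi> u * \<psi> a * \<psi> b" unfolding q_def by (rule quadratic_element(3)[OF \<psi>])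
    have "\<psi> h = \<psi> q * (\<psi> q + \<psi> b) * (\<psi> q + \<psi> b - 1)"
      unfolding h_def using qL by (simp add: hom_onD[OF L \<psi>] hom_on_numeral[OF L \<psi>] subfield_intros[OF L])
    moreover have "(\<psi> a * \<psi> b)\<^sup>2 = 2 * (\<psi> b + 1)" by (simp add: power_mult_distrib a' b')
    then have "- (2 * (\<psi> b + 1)) / 4 \<le> \<psi> q" using quadratic_lower_bound[of "\<psi> a" "\<psi> b" "\<psi> u"] unfolding q' by linarith
    moreover have "\<psi> q \<le> 1 - \<psi> b" using lt by (simp add: q' a' b')
    ultimately show "\<bar>\<psi> h\<bar> \<le> 4 / 10"
      using aux_bound_4_5[OF b', of "\<psi> q"] by simp
  qed auto
qed

lemma card_indep_le_5_5:
  assumes sk: "s = 5" "k = 5" and va: "v_arithmetic A" and u: "algebraic_int u" "2 < u" "u < 14"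
    and B: "finite B" "B \<subseteq> K" "lin_indep_over \<rat> B"
  shows "card B \<le> 13"
proof -
  note K = is_subfield_ground_field and L = is_subfield_entry_field
  have b: "b\<^sup>2 = b + 1" "sqrt 5 = 2 * b - 1" "0 < b" using two_cos_pi_5 by (simp_all add: b_def sk)
  have b_le: "1618 / 1000 < b" "b < 16181 / 10000" using b(1,3) by (cases rule: golden_cases; simp)+
  have b_eq: "b = (1 + sqrt 5) / 2" using b(2) by simp
  have b_int: "algebraic_int b"
    by (rule algebraic_int.intros[of "[:-1, -1, 1:]"]) (use b(1) in \<open>auto simp: coeff_pCons power2_eq_square algebra_simps split: nat.splits\<close>)
  have bK: "b \<in> K" using subfield_diff[OF K cyclic_products_in_ground_field(3) subfieldD(2)[OF K]] b(1) by simp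
  have "sqrt 5 \<in> K" unfolding b(2) using bK by (intro subfield_intros[OF K])
  have a: "a = b" by (simp add: a_def b_def sk)
  have a_int: "algebraic_int a" by (simp add: a b_int)
  \<comment> \<open>Now \<open>u * a * b\<close> equals \<open>u * b\<^sup>2\<close>, and
    \<open>b\<^sup>2\<close> is in \<open>K\<close>.\<close>
  have uK: "u \<in> K"
    using subfield_divide[OF K cyclic_products_in_ground_field(4) cyclic_products_in_ground_field(3)] b(3) by (simp add: a power2_eq_square)
  have F0: "is_subfield (simple_field u)" by (rule is_subfield_simple_field[OF u(1)])
  define F where "F = adjoin (simple_field u) (sqrt 5)"
  have F: "is_subfield F" unfolding F_def using subfield_numeral[OF F0] by (intro is_subfield_adjoin[OF F0]) simp
  have uF: "u \<in> F" using subset_adjoin[OF F0, of "sqrt 5"] mem_simple_field[of u] by (auto simp: F_def)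
  have bF: "b \<in> F" unfolding b_eq using root_mem_adjoin[OF F0] by (intro subfield_intros[OF F]) (simp add: F_def)
  have F_sub: "F \<subseteq> K" unfolding F_def
    by (rule adjoin_least[OF K simple_field_least[OF K uK] \<open>sqrt 5 \<in> K\<close>])
  have "K = F" by (rule ground_field_eqI[OF F F_sub, of 1 1 1]) (simp_all add: a uF bF subfieldD[OF F])
  then obtain \<Phi> where fam: "norm_family K \<Phi>"
    using norm_family_adjoin_sqrt[OF u(1), of 5] unfolding F_def by auto
  define q where "q = u\<^sup>2 + u * a * b"
  define h where "h = b ^ 4 * ((q + b) * (q + 2 * b - 2))"
  have q: "q \<in> K" "algebraic_int q" unfolding q_def using quadratic_element u(1) a_int b_int by auto
  have "u * u > 4" "u * u < 196" using u mult_strict_mono[of 2 u 2 u] mult_strict_mono[of u 14 u 14] by auto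
  moreover have "u * a * b = u * (b + 1)" using b(1) by (simp add: a power2_eq_square mult.assoc)
  moreover have "0 < u * (b + 1)" "u * (b + 1) < 14 * (26181 / 10000)"
    using u b_le mult_strict_mono[of u 14 "b + 1" "26181/10000"] by auto
  ultimately have q_le: "4 < q" "q < 232.7" unfolding q_def power2_eq_square by linarith+
  show ?thesis
  proof (rule card_indep_le[OF va _ _ _ fam _ _ _ _ _ _ _ _ B, where \<rho> = "33 / 100" and h = h])
    show "u \<in> adjoin K (sqrt 2)" "a \<in> adjoin K (sqrt 2)" "b \<in> adjoin K (sqrt 2)"
      using subset_adjoin[OF K, of "sqrt 2"] uK bK subfieldD[OF K] by (auto simp: a)
    show "h \<in> K" unfolding h_def using q bK by (intro subfield_intros[OF K])
    show "algebraic_int h" unfolding h_def using q(2) b_int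
      by (intro algebraic_int_mult algebraic_int_power algebraic_int_diff algebraic_int_add) auto
    show "h \<noteq> 0" using q_le b_le by (simp add: h_def)
    show "\<bar>h\<bar> \<le> 68544 / 10000 * (234.4 * 234)"
      unfolding h_def abs_mult using q_le b_le by (intro mult_mono) (auto simp: golden_powers[OF b(1)])
    show "68544 / 10000 * (234.4 * 234) * (33 / 100) ^ 13 < (1::real)" by (simp add: power_divide)
    fix \<psi> :: "real \<Rightarrow> real"
    assume \<psi>: "hom_on L \<psi>" and lt: "(\<psi> u)\<^sup>2 + \<psi> u * \<psi> a * \<psi> b + (\<psi> a)\<^sup>2 + (\<psi> b)\<^sup>2 < 4"
    have qL: "q \<in> L" "b \<in> L" using q(1) bK ground_field_subset_entry_field by blast+
    have "\<psi> (b\<^sup>2) = \<psi> (b + 1)" using b(1) by simp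
    then have b': "(\<psi> b)\<^sup>2 = \<psi> b + 1" using qL by (simp add: hom_onD[OF L \<psi>] subfieldD[OF L])
    have a': "\<psi> a = \<psi> b" by (simp add: a)
    have q': "\<psi> q = (\<psi> u)\<^sup>2 + \<psi> u * \<psi> a * \<psi> b" unfolding q_def by (rule quadratic_element(3)[OF \<psi>])
    have "\<psi> h = \<psi> b ^ 4 * ((\<psi> q + \<psi> b) * (\<psi> q + 2 * \<psi> b - 2))"
      unfolding h_def using qL by (simp add: hom_onD[OF L \<psi>] hom_on_numeral[OF L \<psi>] subfield_intros[OF L])
    moreover have "(\<psi> a * \<psi> b)\<^sup>2 = \<psi> b ^ 4" by (simp add: a' power_mult_distrib flip: power_add)
    then have "- (\<psi> b ^ 4) / 4 \<le> \<psi> q" using quadratic_lower_bound[of "\<psi> a" "\<psi> b" "\<psi> u"] unfolding q' by linarith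
    moreover have "\<psi> q \<le> 2 - 2 * \<psi> b" using lt by (simp add: q' a' b')
    ultimately show "\<bar>\<psi> h\<bar> \<le> 33 / 100"
      using aux_bound_5_5[OF b', of "\<psi> q"] by simp
  qed auto
qed

end

section \<open>From bounds over the rationals to relative degrees\<close>

lemma sqrt_notin_Rats:
  assumes "m\<^sup>2 < n" "n < (Suc m)\<^sup>2"
  shows "sqrt (real n) \<notin> \<rat>"
proof
  assume "sqrt (real n) \<in> \<rat>"
  \<comment> \<open>A rational algebraic integer is an integer, but none lies strictly between
    \<open>m\<close> and \<open>Suc m\<close>.\<close>
  moreover have "algebraic_int (sqrt (real n))"
    by (intro algebraic_int_sqrt int_imp_algebraic_int) simp
  ultimately have "sqrt (real n) \<in> \<int>" by (intro rational_algebraic_int_is_int)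
  then obtain i :: int where i: "sqrt (real n) = of_int i" by (auto elim: Ints_cases)
  have "real m < sqrt (real n)" using assms(1) by (intro real_less_rsqrt) (simp flip: of_nat_power)
  moreover have "sqrt (real n) < real (Suc m)"
    using assms(2) by (intro real_less_lsqrt) (simp_all flip: of_nat_power del: of_nat_Suc)
  ultimately have "of_int (int m) < real_of_int i" "real_of_int i < of_int (int (Suc m))" unfolding i by simp_all
  then have "int m < i" "i < int (Suc m)" by (simp_all only: of_int_less_iff)
  then show False by linarith
qed

lemma gen_field_sqrt_5: "gen_field {sqrt 5} = adjoin \<rat> (sqrt 5)"
proof
  show "gen_field {sqrt 5} \<subseteq> adjoin \<rat> (sqrt 5)"
    using is_subfield_adjoin[OF is_subfield_Rats, of "sqrt 5"] root_mem_adjoin[OF is_subfield_Rats]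
    by (intro gen_field_least) auto
  show "adjoin \<rat> (sqrt 5) \<subseteq> gen_field {sqrt 5}"
    using subfield_Rats[OF is_subfield_gen_field] gen_field_base[of "sqrt 5"]
    by (intro adjoin_least[OF is_subfield_gen_field]) auto
qed

lemma sqrt_5_notin_Rats: "sqrt 5 \<notin> \<rat>"
  using sqrt_notin_Rats[of 2 5] by simp

text \<open>Squaring \<open>x + y * sqrt 5\<close> and comparing coefficients of
  \<open>sqrt 5\<close> gives \<open>x * y = 0\<close>, so \<open>sqrt 2\<close> or
  \<open>sqrt 10\<close> would be rational.\<close>

lemma sqrt_2_notin_gen_field_sqrt_5: "sqrt 2 \<notin> gen_field {sqrt 5}"
proof
  assume "sqrt 2 \<in> gen_field {sqrt 5}"
  then obtain x y where xy: "x \<in> \<rat>" "y \<in> \<rat>" "sqrt 2 = x + y * sqrt 5"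
    by (auto simp: gen_field_sqrt_5 adjoin_def)
  have "2 = (x + y * sqrt 5)\<^sup>2" by (simp flip: xy(3))
  also have "\<dots> = (x\<^sup>2 + 5 * y\<^sup>2) + (2 * x * y) * sqrt 5"
    by (simp add: power2_sum power_mult_distrib)
  finally have "2 + 0 * sqrt 5 = (x\<^sup>2 + 5 * y\<^sup>2) + (2 * x * y) * sqrt 5" by simp
  then have "0 = 2 * x * y"
    using adjoin_unique(2)[OF is_subfield_Rats sqrt_5_notin_Rats, of 2 0 "x\<^sup>2 + 5 * y\<^sup>2" "2 * x * y"] xy(1,2) by auto
  then consider "y = 0" | "x = 0" by auto
  then show False
  proof cases
    case 1
    then show False using xy sqrt_notin_Rats[of 1 2] by (simp add: power2_eq_square)
  next
    case 2
    then have "sqrt 2 * sqrt 5 = 5 * y" using xy(3) by simp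
    then have "sqrt 10 = 5 * y" by (simp flip: real_sqrt_mult)
    then show False using xy(2) sqrt_notin_Rats[of 3 10] by simp
  qed
qed

lemma ext_degree_Rats_le:
  assumes K: "is_subfield K"
    and bnd: "\<And>B. finite B \<Longrightarrow> B \<subseteq> K \<Longrightarrow> lin_indep_over \<rat> B \<Longrightarrow> card B \<le> D"
  shows "ext_degree (gen_field {}) K \<le> enat D"
  unfolding gen_field_empty by (rule ext_degree_leI[OF is_subfield_Rats subfield_Rats[OF K] K bnd])

text \<open>An independent set over the quadratic field, together with its multiple by
  \<open>sqrt 5\<close>, is independent over the rationals and twice as large.\<close>

lemma card_indep_sqrt_5_le:
  assumes K: "is_subfield K" "sqrt 5 \<in> K"
    and bnd: "\<And>B. finite B \<Longrightarrow> B \<subseteq> K \<Longrightarrow> lin_indep_over \<rat> B \<Longrightarrow> card B \<le> D"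
    and B: "finite B" "B \<subseteq> K" "lin_indep_over (gen_field {sqrt 5}) B"
  shows "2 * card B \<le> D"
proof -
  have "sqrt 5 \<in> gen_field {sqrt 5}" by (simp add: gen_field_base)
  note dbl = card_double_lin_indep[OF is_subfield_gen_field subfield_Rats[OF is_subfield_gen_field]
      is_subfield_Rats this sqrt_5_notin_Rats B(1,3)]
  show ?thesis unfolding dbl(2)[symmetric] using B K(2) dbl(1)
    by (intro bnd) (auto intro: subfieldD[OF K(1)])
qed

lemma ext_degree_sqrt_5_le:
  assumes K: "is_subfield K" "sqrt 5 \<in> K"
    and bnd: "\<And>B. finite B \<Longrightarrow> B \<subseteq> K \<Longrightarrow> lin_indep_over \<rat> B \<Longrightarrow> card B \<le> D"
  shows "gen_field {sqrt 5} \<subseteq> K" "ext_degree (gen_field {sqrt 5}) K \<le> enat (D div 2)"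
proof -
  show sub: "gen_field {sqrt 5} \<subseteq> K" using K by (intro gen_field_least) auto
  show "ext_degree (gen_field {sqrt 5}) K \<le> enat (D div 2)"
    by (rule ext_degree_leI[OF is_subfield_gen_field sub K(1)])
       (use card_indep_sqrt_5_le[OF K bnd] in \<open>fastforce simp: less_eq_div_iff_mult_less_eq mult.commute\<close>)
qed

text \<open>The doubling is done twice: by \<open>sqrt 2\<close> down to the field of
  \<open>sqrt 5\<close>, then by \<open>sqrt 5\<close> down to the rationals.\<close>

lemma ext_degree_sqrt_2_sqrt_5_le:
  assumes K: "is_subfield K" "sqrt 5 \<in> K" "sqrt 2 \<in> K"
    and bnd: "\<And>B. finite B \<Longrightarrow> B \<subseteq> K \<Longrightarrow> lin_indep_over \<rat> B \<Longrightarrow> card B \<le> D"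
  shows "gen_field {sqrt 2, sqrt 5} \<subseteq> K" "ext_degree (gen_field {sqrt 2, sqrt 5}) K \<le> enat (D div 4)"
proof -
  show sub: "gen_field {sqrt 2, sqrt 5} \<subseteq> K" using K by (intro gen_field_least) auto
  have sub5: "gen_field {sqrt 5} \<subseteq> gen_field {sqrt 2, sqrt 5}"
    by (intro gen_field_least is_subfield_gen_field) (simp add: gen_field_base)
  have mem: "sqrt 2 \<in> gen_field {sqrt 2, sqrt 5}" by (simp add: gen_field_base)
  have "card B \<le> D div 4"
    if B: "finite B" "B \<subseteq> K" "lin_indep_over (gen_field {sqrt 2, sqrt 5}) B" for B
  proof -
    note dbl = card_double_lin_indep[OF is_subfield_gen_field sub5 is_subfield_gen_field mem
        sqrt_2_notin_gen_field_sqrt_5 B(1,3)]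
    have "2 * (2 * card B) \<le> D" unfolding dbl(2)[symmetric] using B K(3) dbl(1)
      by (intro card_indep_sqrt_5_le[OF K(1,2) bnd]) (auto intro: subfieldD[OF K(1)])
    then show ?thesis by simp
  qed
  then show "ext_degree (gen_field {sqrt 2, sqrt 5}) K \<le> enat (D div 4)"
    by (intro ext_degree_leI[OF is_subfield_gen_field sub K(1)])
qed

theorem theorem4p7:
  fixes s k :: nat and u :: real
  assumes "3 \<le> s" and "s \<le> k" and "k \<le> 5"
    and "totally_real_algebraic_integer u"
    and "2 < u" and "u < 14"
    and "v_arithmetic (tri_matrix u s k)"
  defines "K \<equiv> ground_field (tri_matrix u s k)"
  shows "(s = 3 \<and> k = 3 \<longrightarrow> ext_degree (gen_field {}) K \<le> 23)
     \<and> (s = 3 \<and> k = 4 \<longrightarrow> ext_degree (gen_field {}) K \<le> 12)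
     \<and> (s = 4 \<and> k = 4 \<longrightarrow> ext_degree (gen_field {}) K \<le> 8)
     \<and> (s = 3 \<and> k = 5 \<longrightarrow> gen_field {sqrt 5} \<subseteq> K \<and> ext_degree (gen_field {sqrt 5}) K \<le> 7)
     \<and> (s = 4 \<and> k = 5 \<and> sqrt 2 \<in> K \<longrightarrow>
          gen_field {sqrt 2, sqrt 5} \<subseteq> K \<and> ext_degree (gen_field {sqrt 2, sqrt 5}) K \<le> 5)
     \<and> (s = 4 \<and> k = 5 \<and> sqrt 2 \<notin> K \<longrightarrow>
          gen_field {sqrt 5} \<subseteq> K \<and> ext_degree (gen_field {sqrt 5}) K \<le> 11)
     \<and> (s = 5 \<and> k = 5 \<longrightarrow> gen_field {sqrt 5} \<subseteq> K \<and> ext_degree (gen_field {sqrt 5}) K \<le> 6)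
     \<and> ext_degree (gen_field {}) K \<le> 23"
proof -
  have va: "v_arithmetic (tri_matrix u s k)" by fact
  have u: "algebraic_int u" "2 < u" "u < 14"
    using assms(4-6) by (auto simp: totally_real_algebraic_integer_def)
  have K: "is_subfield K" unfolding K_def by (rule is_subfield_ground_field)
  have sqrt5: "sqrt 5 \<in> K" if "k = 5"
  proof -
    have mem: "(2 * cos (pi / real k))\<^sup>2 \<in> K" unfolding K_def by (rule cyclic_products_in_ground_field(3))
    \<comment> \<open>The identity \<open>2 * b - 1\<close> for \<open>sqrt 5\<close>, rewritten in
      terms of the cyclic product \<open>b\<^sup>2 = b + 1\<close>.\<close>
    have eq: "sqrt 5 = 2 * (2 * cos (pi / real k))\<^sup>2 - 3" using two_cos_pi_5(1,3) that by simp
    show ?thesis unfolding eq by (intro subfield_diff[OF K] subfieldD(4)[OF K] subfield_numeral[OF K] mem)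
  qed
  consider (33) "s = 3" "k = 3" | (34) "s = 3" "k = 4" | (44) "s = 4" "k = 4" | (35) "s = 3" "k = 5"
    | (45) "s = 4" "k = 5" | (55) "s = 5" "k = 5" using assms(1-3) by linarith
  then show ?thesis
  proof cases
    case 33
    note bnd = card_indep_le_3_3[OF 33 va u, folded K_def]
    show ?thesis using 33 ext_degree_Rats_le[OF K bnd] by (simp add: numeral_eq_enat)
  next
    case 34
    note bnd = card_indep_le_3_4[OF 34 va u, folded K_def]
    have "ext_degree (gen_field {}) K \<le> 12" using ext_degree_Rats_le[OF K bnd] by (simp add: numeral_eq_enat)
    also have "\<dots> \<le> (23 :: enat)" by simp
    finally show ?thesis using 34 \<open>ext_degree (gen_field {}) K \<le> 12\<close> by simp
  next
    case 44
    note bnd = card_indep_le_4_4[OF 44 va u, folded K_def]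
    have "ext_degree (gen_field {}) K \<le> 8" using ext_degree_Rats_le[OF K bnd] by (simp add: numeral_eq_enat)
    also have "\<dots> \<le> (23 :: enat)" by simp
    finally show ?thesis using 44 \<open>ext_degree (gen_field {}) K \<le> 8\<close> by simp
  next
    case 35
    note bnd = card_indep_le_3_5[OF 35 va u, folded K_def]
    have "ext_degree (gen_field {}) K \<le> 15" using ext_degree_Rats_le[OF K bnd] by (simp add: numeral_eq_enat)
    also have "\<dots> \<le> (23 :: enat)" by simp
    finally show ?thesis using 35 ext_degree_sqrt_5_le[OF K sqrt5 bnd] by (simp add: numeral_eq_enat)
  next
    case 45
    \<comment> \<open>One bound serves three conclusions: 23 over the rationals,
      \<open>23 div 2 = 11\<close> and \<open>23 div 4 = 5\<close>.\<close>
    note bnd = card_indep_le_4_5[OF 45 va u, folded K_def]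
    show ?thesis
      using 45 ext_degree_Rats_le[OF K bnd] ext_degree_sqrt_5_le[OF K sqrt5 bnd]
        ext_degree_sqrt_2_sqrt_5_le[OF K sqrt5 _ bnd]
      by (simp add: numeral_eq_enat)
  next
    case 55
    note bnd = card_indep_le_5_5[OF 55 va u, folded K_def]
    have "ext_degree (gen_field {}) K \<le> 13" using ext_degree_Rats_le[OF K bnd] by (simp add: numeral_eq_enat)
    also have "\<dots> \<le> (23 :: enat)" by simp
    finally show ?thesis using 55 ext_degree_sqrt_5_le[OF K sqrt5 bnd] by (simp add: numeral_eq_enat)
  qed
qed

end
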